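(* There are no almost Kenmotsu generalized $(\kappa,\mu,\nu)$-space forms $M(f_1,\ldots,f_8)$ of dimension greater than or equal to $5$ with $\kappa=f_1-f_3<-1$.
   Context: Manifolds, tensor fields and functions are smooth. An almost contact metric manifold $(M,\phi,\xi,\eta,g)$ is an odd-dimensional Riemannian manifold $(M,g)$ with a $(1,1)$-tensor field $\phi$, a vector field $\xi$ and a 1-form $\eta$ such that $\eta(\xi)=1$, $\phi^2X=-X+\eta(X)\xi$ and $g(\phi X,\phi Y)=g(X,Y)-\eta(X)\eta(Y)$. Its fundamental 2-form is $\Phi(X,Y)=g(X,\phi Y)$. It is almost Kenmotsu if $d\eta=0$ and $d\Phi=2\eta\wedge\Phi$. Put $h=\frac12L_\xi\phi$ ($L$ the Lie derivative) and $R(X,Y)Z=\nabla_X\nabla_YZ-\nabla_Y\nabla_XZ-\nabla_{[X,Y]}Z$, with $\nabla$ the Levi-Civita connection. A generalized $(\kappa,\mu,\nu)$-space form, denoted $M(f_1,\ldots,f_8)$, is an almost contact metric manifold whose curvature tensor can be written as $R=f_1R_1+f_2R_2+f_3R_3+f_4R_4+f_5R_5+f_6R_6+f_7R_7+f_8R_8$ with $f_1,\ldots,f_8$ functions on $M$, where for all vector fields $X,Y,Z$: $R_1(X,Y)Z=g(Y,Z)X-g(X,Z)Y$; $R_2(X,Y)Z=g(X,\phi Z)\phi Y-g(Y,\phi Z)\phi X+2g(X,\phi Y)\phi Z$; $R_3(X,Y)Z=\eta(X)\eta(Z)Y-\eta(Y)\eta(Z)X+g(X,Z)\eta(Y)\xi-g(Y,Z)\eta(X)\xi$;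 $R_4(X,Y)Z=g(Y,Z)hX-g(X,Z)hY+g(hY,Z)X-g(hX,Z)Y$; $R_5(X,Y)Z=g(hY,Z)hX-g(hX,Z)hY+g(\phi hX,Z)\phi hY-g(\phi hY,Z)\phi hX$; $R_6(X,Y)Z=\eta(X)\eta(Z)hY-\eta(Y)\eta(Z)hX+g(hX,Z)\eta(Y)\xi-g(hY,Z)\eta(X)\xi$; $R_7(X,Y)Z=g(Y,Z)\phi hX-g(X,Z)\phi hY+g(\phi hY,Z)X-g(\phi hX,Z)Y$; $R_8(X,Y)Z=\eta(X)\eta(Z)\phi hY-\eta(Y)\eta(Z)\phi hX+g(\phi hX,Z)\eta(Y)\xi-g(\phi hY,Z)\eta(X)\xi$. *)

theory Defs
  imports "HOL-Analysis.Analysis" "HOL-Library.Function_Algebras"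
begin

section \<open>Smooth manifolds\<close>

text \<open>
  \<open>Ck_on k f S\<close> is meant for open \<open>S\<close>; all iterated directional derivatives up to order \<open>k\<close> are
  required to exist and to be continuous.
\<close>

primrec Ck_on ::
  "nat \<Rightarrow> ('e::real_normed_vector \<Rightarrow> 'b::real_normed_vector) \<Rightarrow> 'e set \<Rightarrow> bool"
where
  "Ck_on 0 f S \<longleftrightarrow> continuous_on S f"
| "Ck_on (Suc k) f S \<longleftrightarrow>
     (\<forall>x\<in>S. f differentiable (at x)) \<and> (\<forall>v. Ck_on k (\<lambda>x. frechet_derivative f (at x) v) S)"

definition smooth_on ::
  "('e::real_normed_vector \<Rightarrow> 'b::real_normed_vector) \<Rightarrow> 'e set \<Rightarrow> bool"
  where "smooth_on f S \<longleftrightarrow> (\<forall>k. Ck_on k f S)"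

text \<open>
  The underlying space of a manifold is a whole type \<open>'a\<close>, Hausdorff and second countable, and
  the model space is a Euclidean space \<open>'e\<close>, so the dimension of the manifold is \<open>DIM('e)\<close>.
  A chart is a pair of its domain and its coordinate map. The atlas need not be maximal.
\<close>

type_synonym ('a, 'e) atlas = "('a set \<times> ('a \<Rightarrow> 'e)) set"

definition chart :: "'a::topological_space set \<times> ('a \<Rightarrow> 'e::euclidean_space) \<Rightarrow> bool"
  where "chart c \<longleftrightarrow> (case c of (U, x) \<Rightarrow>
    open U \<and> open (x ` U) \<and> homeomorphism U (x ` U) x (inv_into U x))"

definition smooth_atlas ::
  "('a::{t2_space, second_countable_topology}, 'e::euclidean_space) atlas \<Rightarrow> bool"
  where "smooth_atlas A \<longleftrightarrow>
    (\<forall>c\<in>A. chart c) \<and>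
    (\<Union>(U, x)\<in>A. U) = UNIV \<and>
    (\<forall>(U, x)\<in>A. \<forall>(V, y)\<in>A. smooth_on (y \<circ> inv_into U x) (x ` (U \<inter> V)))"

definition smooth_functions ::
  "('a::{t2_space, second_countable_topology}, 'e::euclidean_space) atlas \<Rightarrow> ('a \<Rightarrow> real) set"
  where "smooth_functions A = {f. \<forall>(U, x)\<in>A. smooth_on (f \<circ> inv_into U x) (x ` U)}"


section \<open>Vector fields and tensor fields\<close>

text \<open>
  Smooth vector fields are the derivations of the algebra of smooth functions. As HOL functions are
  total, a vector field is required to send nonsmooth functions to \<open>0\<close>; then equality of vector
  fields is plain equality. Sums and products of functions and of vector fields are the pointwise
  ones of \<^theory>\<open>HOL-Library.Function_Algebras\<close>.
\<close>

type_synonym 'a vfield = "('a \<Rightarrow> real) \<Rightarrow> 'a \<Rightarrow> real"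

definition vector_fields ::
  "('a::{t2_space, second_countable_topology}, 'e::euclidean_space) atlas \<Rightarrow> 'a vfield set"
  where "vector_fields A = {X.
    (\<forall>u\<in>smooth_functions A. X u \<in> smooth_functions A) \<and>
    (\<forall>u. u \<notin> smooth_functions A \<longrightarrow> X u = 0) \<and>
    (\<forall>u\<in>smooth_functions A. \<forall>v\<in>smooth_functions A. \<forall>a b.
       X (\<lambda>p. a * u p + b * v p) = (\<lambda>p. a * X u p + b * X v p)) \<and>
    (\<forall>u\<in>smooth_functions A. \<forall>v\<in>smooth_functions A. X (u * v) = u * X v + v * X u)}"

definition scale :: "('a \<Rightarrow> real) \<Rightarrow> 'a vfield \<Rightarrow> 'a vfield"  (infixr \<open>\<odot>\<close> 69)
  where "u \<odot> X = (\<lambda>v. u * X v)"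

definition lie_bracket :: "'a vfield \<Rightarrow> 'a vfield \<Rightarrow> 'a vfield"
  where "lie_bracket X Y = (\<lambda>u. X (Y u) - Y (X u))"

definition vanishes_at :: "'a vfield \<Rightarrow> 'a \<Rightarrow> bool"
  where "vanishes_at X p \<longleftrightarrow> (\<forall>u. X u p = 0)"

text \<open>
  Tensor fields are maps on vector fields that are linear over the smooth functions in each
  argument; their values outside \<open>vector_fields A\<close> are irrelevant.
\<close>

definition one_form ::
  "('a::{t2_space, second_countable_topology}, 'e::euclidean_space) atlas
    \<Rightarrow> ('a vfield \<Rightarrow> 'a \<Rightarrow> real) \<Rightarrow> bool"
  where "one_form A \<omega> \<longleftrightarrow>
    (\<forall>X\<in>vector_fields A. \<omega> X \<in> smooth_functions A) \<and>
    (\<forall>X\<in>vector_fields A. \<forall>Y\<in>vector_fields A. \<omega> (X + Y) = \<omega> X + \<omega> Y) \<and>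
    (\<forall>u\<in>smooth_functions A. \<forall>X\<in>vector_fields A. \<omega> (u \<odot> X) = u * \<omega> X)"

definition tensor_field_11 ::
  "('a::{t2_space, second_countable_topology}, 'e::euclidean_space) atlas
    \<Rightarrow> ('a vfield \<Rightarrow> 'a vfield) \<Rightarrow> bool"
  where "tensor_field_11 A T \<longleftrightarrow>
    (\<forall>X\<in>vector_fields A. T X \<in> vector_fields A) \<and>
    (\<forall>X\<in>vector_fields A. \<forall>Y\<in>vector_fields A. T (X + Y) = T X + T Y) \<and>
    (\<forall>u\<in>smooth_functions A. \<forall>X\<in>vector_fields A. T (u \<odot> X) = u \<odot> T X)"

definition riemannian_metric ::
  "('a::{t2_space, second_countable_topology}, 'e::euclidean_space) atlas
    \<Rightarrow> ('a vfield \<Rightarrow> 'a vfield \<Rightarrow> 'a \<Rightarrow> real) \<Rightarrow> bool"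
  where "riemannian_metric A g \<longleftrightarrow>
    (\<forall>X\<in>vector_fields A. one_form A (g X)) \<and>
    (\<forall>X\<in>vector_fields A. \<forall>Y\<in>vector_fields A. g X Y = g Y X) \<and>
    (\<forall>X\<in>vector_fields A. \<forall>p. g X X p \<ge> 0 \<and> (g X X p = 0 \<longleftrightarrow> vanishes_at X p))"

definition lie_derivative_11 ::
  "'a vfield \<Rightarrow> ('a vfield \<Rightarrow> 'a vfield) \<Rightarrow> 'a vfield \<Rightarrow> 'a vfield"
  where "lie_derivative_11 V T X = lie_bracket V (T X) - T (lie_bracket V X)"

text \<open>
  The exterior derivative and the wedge product follow the convention without numerical factors. With
  the other usual convention, \<open>d\<omega>\<close> for a 1-form acquires a factor \<open>1/2\<close>, and both \<open>d\<Phi>\<close> for a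
  2-form and \<open>\<eta> \<and> \<Phi>\<close> acquire a factor \<open>1/3\<close>, so the equations \<open>d\<eta> = 0\<close> and \<open>d\<Phi> = 2\<eta> \<and> \<Phi>\<close> do not
  depend on the choice.
\<close>

definition ext_deriv_1 :: "('a vfield \<Rightarrow> 'a \<Rightarrow> real) \<Rightarrow> 'a vfield \<Rightarrow> 'a vfield \<Rightarrow> 'a \<Rightarrow> real"
  where "ext_deriv_1 \<omega> X Y = X (\<omega> Y) - Y (\<omega> X) - \<omega> (lie_bracket X Y)"

definition ext_deriv_2 ::
  "('a vfield \<Rightarrow> 'a vfield \<Rightarrow> 'a \<Rightarrow> real) \<Rightarrow> 'a vfield \<Rightarrow> 'a vfield \<Rightarrow> 'a vfield \<Rightarrow> 'a \<Rightarrow> real"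
  where "ext_deriv_2 \<omega> X Y Z =
    X (\<omega> Y Z) + Y (\<omega> Z X) + Z (\<omega> X Y)
    - \<omega> (lie_bracket X Y) Z - \<omega> (lie_bracket Y Z) X - \<omega> (lie_bracket Z X) Y"

definition wedge_12 ::
  "('a vfield \<Rightarrow> 'a \<Rightarrow> real) \<Rightarrow> ('a vfield \<Rightarrow> 'a vfield \<Rightarrow> 'a \<Rightarrow> real)
    \<Rightarrow> 'a vfield \<Rightarrow> 'a vfield \<Rightarrow> 'a vfield \<Rightarrow> 'a \<Rightarrow> real"
  where "wedge_12 \<alpha> \<omega> X Y Z = \<alpha> X * \<omega> Y Z + \<alpha> Y * \<omega> Z X + \<alpha> Z * \<omega> X Y"


section \<open>Levi-Civita connection and curvature\<close>

definition affine_connection ::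
  "('a::{t2_space, second_countable_topology}, 'e::euclidean_space) atlas
    \<Rightarrow> ('a vfield \<Rightarrow> 'a vfield \<Rightarrow> 'a vfield) \<Rightarrow> bool"
  where "affine_connection A D \<longleftrightarrow>
    (\<forall>Y\<in>vector_fields A. tensor_field_11 A (\<lambda>X. D X Y)) \<and>
    (\<forall>X\<in>vector_fields A. \<forall>Y\<in>vector_fields A. \<forall>Z\<in>vector_fields A. D X (Y + Z) = D X Y + D X Z) \<and>
    (\<forall>u\<in>smooth_functions A. \<forall>X\<in>vector_fields A. \<forall>Y\<in>vector_fields A.
       D X (u \<odot> Y) = X u \<odot> Y + u \<odot> D X Y)"

definition levi_civita ::
  "('a::{t2_space, second_countable_topology}, 'e::euclidean_space) atlas
    \<Rightarrow> ('a vfield \<Rightarrow> 'a vfield \<Rightarrow> 'a \<Rightarrow> real) \<Rightarrow> ('a vfield \<Rightarrow> 'a vfield \<Rightarrow> 'a vfield) \<Rightarrow> bool"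
  where "levi_civita A g D \<longleftrightarrow>
    affine_connection A D \<and>
    (\<forall>X\<in>vector_fields A. \<forall>Y\<in>vector_fields A. D X Y - D Y X = lie_bracket X Y) \<and>
    (\<forall>X\<in>vector_fields A. \<forall>Y\<in>vector_fields A. \<forall>Z\<in>vector_fields A.
       X (g Y Z) = g (D X Y) Z + g Y (D X Z))"

definition curvature ::
  "('a vfield \<Rightarrow> 'a vfield \<Rightarrow> 'a vfield) \<Rightarrow> 'a vfield \<Rightarrow> 'a vfield \<Rightarrow> 'a vfield \<Rightarrow> 'a vfield"
  where "curvature D X Y Z = D X (D Y Z) - D Y (D X Z) - D (lie_bracket X Y) Z"


section \<open>Almost contact metric and almost Kenmotsu manifolds\<close>

definition almost_contact_metric_manifold ::
  "('a::{t2_space, second_countable_topology}, 'e::euclidean_space) atlas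
    \<Rightarrow> ('a vfield \<Rightarrow> 'a vfield) \<Rightarrow> 'a vfield \<Rightarrow> ('a vfield \<Rightarrow> 'a \<Rightarrow> real)
    \<Rightarrow> ('a vfield \<Rightarrow> 'a vfield \<Rightarrow> 'a \<Rightarrow> real) \<Rightarrow> bool"
  where "almost_contact_metric_manifold A \<phi> \<xi> \<eta> g \<longleftrightarrow>
    smooth_atlas A \<and> odd DIM('e) \<and>
    riemannian_metric A g \<and> tensor_field_11 A \<phi> \<and> \<xi> \<in> vector_fields A \<and> one_form A \<eta> \<and>
    \<eta> \<xi> = 1 \<and>
    (\<forall>X\<in>vector_fields A. \<phi> (\<phi> X) = - X + \<eta> X \<odot> \<xi>) \<and>
    (\<forall>X\<in>vector_fields A. \<forall>Y\<in>vector_fields A. g (\<phi> X) (\<phi> Y) = g X Y - \<eta> X * \<eta> Y)"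

definition fundamental_form ::
  "('a vfield \<Rightarrow> 'a vfield) \<Rightarrow> ('a vfield \<Rightarrow> 'a vfield \<Rightarrow> 'a \<Rightarrow> real)
    \<Rightarrow> 'a vfield \<Rightarrow> 'a vfield \<Rightarrow> 'a \<Rightarrow> real"
  where "fundamental_form \<phi> g X Y = g X (\<phi> Y)"

definition almost_kenmotsu_manifold ::
  "('a::{t2_space, second_countable_topology}, 'e::euclidean_space) atlas
    \<Rightarrow> ('a vfield \<Rightarrow> 'a vfield) \<Rightarrow> 'a vfield \<Rightarrow> ('a vfield \<Rightarrow> 'a \<Rightarrow> real)
    \<Rightarrow> ('a vfield \<Rightarrow> 'a vfield \<Rightarrow> 'a \<Rightarrow> real) \<Rightarrow> bool"
  where "almost_kenmotsu_manifold A \<phi> \<xi> \<eta> g \<longleftrightarrow>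
    almost_contact_metric_manifold A \<phi> \<xi> \<eta> g \<and>
    (\<forall>X\<in>vector_fields A. \<forall>Y\<in>vector_fields A. ext_deriv_1 \<eta> X Y = 0) \<and>
    (\<forall>X\<in>vector_fields A. \<forall>Y\<in>vector_fields A. \<forall>Z\<in>vector_fields A.
       ext_deriv_2 (fundamental_form \<phi> g) X Y Z = 2 * wedge_12 \<eta> (fundamental_form \<phi> g) X Y Z)"

definition h_tensor :: "('a vfield \<Rightarrow> 'a vfield) \<Rightarrow> 'a vfield \<Rightarrow> 'a vfield \<Rightarrow> 'a vfield"
  where "h_tensor \<phi> \<xi> X = (\<lambda>p. 1/2) \<odot> lie_derivative_11 \<xi> \<phi> X"


section \<open>Generalized \<open>(\<kappa>,\<mu>,\<nu>)\<close>-space forms\<close>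

context
  fixes \<phi> :: "'a vfield \<Rightarrow> 'a vfield"
    and \<xi> :: "'a vfield"
    and \<eta> :: "'a vfield \<Rightarrow> 'a \<Rightarrow> real"
    and g :: "'a vfield \<Rightarrow> 'a vfield \<Rightarrow> 'a \<Rightarrow> real"
begin

private abbreviation h :: "'a vfield \<Rightarrow> 'a vfield"
  where "h \<equiv> h_tensor \<phi> \<xi>"

definition R1 :: "'a vfield \<Rightarrow> 'a vfield \<Rightarrow> 'a vfield \<Rightarrow> 'a vfield"
  where "R1 X Y Z = g Y Z \<odot> X - g X Z \<odot> Y"

definition R2 :: "'a vfield \<Rightarrow> 'a vfield \<Rightarrow> 'a vfield \<Rightarrow> 'a vfield"
  where "R2 X Y Z =
    g X (\<phi> Z) \<odot> \<phi> Y - g Y (\<phi> Z) \<odot> \<phi> X + (2 * g X (\<phi> Y)) \<odot> \<phi> Z"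

definition R3 :: "'a vfield \<Rightarrow> 'a vfield \<Rightarrow> 'a vfield \<Rightarrow> 'a vfield"
  where "R3 X Y Z =
    (\<eta> X * \<eta> Z) \<odot> Y - (\<eta> Y * \<eta> Z) \<odot> X + (g X Z * \<eta> Y) \<odot> \<xi> - (g Y Z * \<eta> X) \<odot> \<xi>"

definition R4 :: "'a vfield \<Rightarrow> 'a vfield \<Rightarrow> 'a vfield \<Rightarrow> 'a vfield"
  where "R4 X Y Z =
    g Y Z \<odot> h X - g X Z \<odot> h Y + g (h Y) Z \<odot> X - g (h X) Z \<odot> Y"

definition R5 :: "'a vfield \<Rightarrow> 'a vfield \<Rightarrow> 'a vfield \<Rightarrow> 'a vfield"
  where "R5 X Y Z =
    g (h Y) Z \<odot> h X - g (h X) Z \<odot> h Y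
    + g (\<phi> (h X)) Z \<odot> \<phi> (h Y) - g (\<phi> (h Y)) Z \<odot> \<phi> (h X)"

definition R6 :: "'a vfield \<Rightarrow> 'a vfield \<Rightarrow> 'a vfield \<Rightarrow> 'a vfield"
  where "R6 X Y Z =
    (\<eta> X * \<eta> Z) \<odot> h Y - (\<eta> Y * \<eta> Z) \<odot> h X
    + (g (h X) Z * \<eta> Y) \<odot> \<xi> - (g (h Y) Z * \<eta> X) \<odot> \<xi>"

definition R7 :: "'a vfield \<Rightarrow> 'a vfield \<Rightarrow> 'a vfield \<Rightarrow> 'a vfield"
  where "R7 X Y Z =
    g Y Z \<odot> \<phi> (h X) - g X Z \<odot> \<phi> (h Y) + g (\<phi> (h Y)) Z \<odot> X - g (\<phi> (h X)) Z \<odot> Y"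

definition R8 :: "'a vfield \<Rightarrow> 'a vfield \<Rightarrow> 'a vfield \<Rightarrow> 'a vfield"
  where "R8 X Y Z =
    (\<eta> X * \<eta> Z) \<odot> \<phi> (h Y) - (\<eta> Y * \<eta> Z) \<odot> \<phi> (h X)
    + (g (\<phi> (h X)) Z * \<eta> Y) \<odot> \<xi> - (g (\<phi> (h Y)) Z * \<eta> X) \<odot> \<xi>"

end

text \<open>
  The Levi-Civita connection exists and is unique on vector fields, so the existential
  quantifier over \<open>D\<close> only names it.
\<close>

definition generalized_kmn_space_form ::
  "('a::{t2_space, second_countable_topology}, 'e::euclidean_space) atlas
    \<Rightarrow> ('a vfield \<Rightarrow> 'a vfield) \<Rightarrow> 'a vfield \<Rightarrow> ('a vfield \<Rightarrow> 'a \<Rightarrow> real)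
    \<Rightarrow> ('a vfield \<Rightarrow> 'a vfield \<Rightarrow> 'a \<Rightarrow> real)
    \<Rightarrow> ('a \<Rightarrow> real) \<Rightarrow> ('a \<Rightarrow> real) \<Rightarrow> ('a \<Rightarrow> real) \<Rightarrow> ('a \<Rightarrow> real)
    \<Rightarrow> ('a \<Rightarrow> real) \<Rightarrow> ('a \<Rightarrow> real) \<Rightarrow> ('a \<Rightarrow> real) \<Rightarrow> ('a \<Rightarrow> real) \<Rightarrow> bool"
  where "generalized_kmn_space_form A \<phi> \<xi> \<eta> g f1 f2 f3 f4 f5 f6 f7 f8 \<longleftrightarrow>
    almost_contact_metric_manifold A \<phi> \<xi> \<eta> g \<and>
    {f1, f2, f3, f4, f5, f6, f7, f8} \<subseteq> smooth_functions A \<and>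
    (\<exists>D. levi_civita A g D \<and>
      (\<forall>X\<in>vector_fields A. \<forall>Y\<in>vector_fields A. \<forall>Z\<in>vector_fields A.
        curvature D X Y Z =
          f1 \<odot> R1 g X Y Z + f2 \<odot> R2 \<phi> g X Y Z + f3 \<odot> R3 \<xi> \<eta> g X Y Z + f4 \<odot> R4 \<phi> \<xi> g X Y Z
          + f5 \<odot> R5 \<phi> \<xi> g X Y Z + f6 \<odot> R6 \<phi> \<xi> \<eta> g X Y Z + f7 \<odot> R7 \<phi> \<xi> g X Y Z
          + f8 \<odot> R8 \<phi> \<xi> \<eta> g X Y Z))"

end

theory Submission
  imports Defs
begin

text \<open>
  Let \<open>B = \<nabla>\<xi>\<close> and \<open>H = ker \<eta>\<close>. As \<open>d\<eta> = 0\<close>, the distribution \<open>H\<close> is integrable and \<open>B\<close> is, up to sign, the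
  shape operator of its leaves; \<open>d\<Phi> = 2\<eta> \<and> \<Phi>\<close> implies that \<open>k = B - 1\<close> on \<open>H\<close> is \<open>-\<phi>h\<close> and
  anticommutes with \<open>\<phi>\<close>. The idea is that the prescribed curvature forces the leaves to be Kaehler
  manifolds with a parallel shape operator, and that the curvature of such a leaf cannot have the form that the
  Gauss equation gives to it when \<open>k \<noteq> 0\<close>.

  In a space form, \<open>R(X,Y)\<xi>\<close> depends only on \<open>\<kappa> = f\<^sub>1 - f\<^sub>3\<close>, \<open>\<mu> = f\<^sub>4 - f\<^sub>6\<close> and \<open>\<nu> = f\<^sub>7 - f\<^sub>8\<close>. The part of
  \<open>R(X,\<xi>)\<xi>\<close> that commutes with \<open>\<phi>\<close> gives \<open>k\<^sup>2 = \<sigma>\<close> on \<open>H\<close> with \<open>\<sigma> = -1-\<kappa> > 0\<close> (\<open>k_k\<close>), so \<open>k\<close> is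
  invertible there, and \<open>R(X,Y)\<xi> = 0\<close> on \<open>H\<close> is the Codazzi equation \<open>(\<nabla>\<^sub>Xk)Y = (\<nabla>\<^sub>Yk)X\<close>
  (\<open>dk_commute\<close>). Hence \<open>S(X,Y,Z) = g((\<nabla>\<^sub>Xk)Y,Z)\<close> is totally symmetric on \<open>H\<close>.
  Differentiating \<open>k\<phi> + \<phi>k = 0\<close> and eliminating \<open>S\<close> by its symmetry shows that \<open>\<phi>\<close> is parallel along the
  leaves (\<open>N_zero\<close>). Then \<open>\<phi>\<close> can be moved between the arguments of \<open>S\<close>, and differentiating \<open>k\<^sup>2 = \<sigma>\<close>
  expresses \<open>S\<close> by \<open>d\<sigma>\<close>; the symmetry of \<open>S\<close>, applied to \<open>X\<close> and a vector orthogonal to \<open>X\<close> and \<open>\<phi>X\<close>,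
  which exists because \<open>dim H \<ge> 4\<close>, yields \<open>d\<sigma> = 0\<close> on \<open>H\<close> and \<open>S = 0\<close> (\<open>S_zero\<close>).

  The curvature \<open>L\<close> of the leaves therefore commutes with \<open>\<phi>\<close> and \<open>k\<close>. By the Gauss equation \<open>L\<close> is also
  an explicit expression in the \<open>f\<^sub>i\<close> (\<open>leaf_curvature_formula\<close>). Let \<open>e\<^sub>1, e\<^sub>2\<close> be
  orthonormal eigenvectors of \<open>k\<close> at a point for the same eigenvalue \<open>c\<close>, \<open>c\<^sup>2 = \<sigma>\<close>; these again need \<open>dim H \<ge> 4\<close>.
  Comparing components gives \<open>f\<^sub>2 = f\<^sub>5 = 0\<close>, \<open>f\<^sub>1 + 1 = c\<^sup>2\<close> and \<open>f\<^sub>1 + 1 + c\<^sup>2 + 2c(1 - f\<^sub>7) = 0\<close>. The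
  last equation also holds for \<open>-c\<close>, whose eigenvectors are \<open>\<phi>e\<^sub>1, \<phi>e\<^sub>2\<close>, so \<open>f\<^sub>1 + 1 = -c\<^sup>2\<close>, whence \<open>c = 0\<close>, a
  contradiction.

  Vector fields are global derivations, so no local frames are used: tensor identities are proved for global
  fields, tested against \<open>g\<close>, and vectors adapted to a single point occur only in the last step and for \<open>d\<sigma> = 0\<close>.
  That enough fields exist there follows from bump functions (\<open>orthogonal_vector_field_exists\<close>).
\<close>

section \<open>Calculus of smooth functions\<close>

lemma Ck_on_cong:
  assumes "open S" "\<And>x. x \<in> S \<Longrightarrow> f x = g x" "Ck_on k f S"
  shows "Ck_on k g S"
  using assms(2,3)
proof (induction k arbitrary: f g)
  case 0
  then show ?case by (auto cong: continuous_on_cong)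
next
  case (Suc k)
  have ev: "(f has_derivative F) (at x) = (g has_derivative F) (at x)" if "x \<in> S" for x F
    using Suc.prems(1) that \<open>open S\<close>
    by (metis has_derivative_transform_within_open)
  have "g differentiable at x \<and> frechet_derivative f (at x) = frechet_derivative g (at x)"
    if "x \<in> S" for x
    using ev[OF that] Suc.prems(2) that
    by (simp add: differentiable_def frechet_derivative_def) blast
  then show ?case
    using Suc.prems(2) Suc.IH by (metis (no_types, lifting) Ck_on.simps(2))
qed

lemma Ck_on_subset: "Ck_on k f S \<Longrightarrow> T \<subseteq> S \<Longrightarrow> Ck_on k f T"
  by (induction k arbitrary: f) (auto intro: continuous_on_subset)

lemma Ck_on_locally:
  assumes "\<And>x. x \<in> S \<Longrightarrow> \<exists>T. open T \<and> x \<in> T \<and> Ck_on k f T"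
  shows "Ck_on k f S"
  using assms
proof (induction k arbitrary: f)
  case 0
  then show ?case
    by (metis Ck_on.simps(1) continuous_at_imp_continuous_on continuous_on_eq_continuous_at)
next
  case (Suc k)
  then show ?case by (simp only: Ck_on.simps) metis
qed

lemma Ck_on_SucD: "Ck_on (Suc k) f S \<Longrightarrow> Ck_on k f S"
  by (induction k arbitrary: f)
    (auto intro!: continuous_at_imp_continuous_on differentiable_imp_continuous_within)

lemma Ck_on_has_derivative:
  assumes "open S"
    and "\<And>x. x \<in> S \<Longrightarrow> (f has_derivative F x) (at x)"
    and "\<And>v. Ck_on k (\<lambda>x. F x v) S"
  shows "Ck_on (Suc k) f S"
proof -
  have "frechet_derivative f (at x) = F x" if "x \<in> S" for x
    using assms(2)[OF that] frechet_derivative_at by metis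
  then show ?thesis
    using assms by (auto simp: differentiable_def intro: Ck_on_cong)
qed

lemma Ck_on_Suc_has_derivative:
  assumes "Ck_on (Suc k) f S" "x \<in> S"
  shows "(f has_derivative frechet_derivative f (at x)) (at x)"
  using assms by (simp flip: frechet_derivative_works)

lemma Ck_on_const [simp]: "Ck_on k (\<lambda>x. c) S"
  by (induction k arbitrary: c) (simp_all add: frechet_derivative_const)

lemma Ck_on_bounded_linear:
  assumes "bounded_linear f" "open S"
  shows "Ck_on k f S"
proof (cases k)
  case 0
  then show ?thesis using assms by (simp add: linear_continuous_on)
next
  case (Suc m)
  then show ?thesis
    using assms unfolding Suc
    by (intro Ck_on_has_derivative[where F="\<lambda>_. f"] bounded_linear_imp_has_derivative) auto
qed

lemma Ck_on_add:
  assumes "open S" "Ck_on k f S" "Ck_on k g S"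
  shows "Ck_on k (\<lambda>x. f x + g x) S"
  using assms(2,3)
proof (induction k arbitrary: f g)
  case 0
  then show ?case by (simp add: continuous_on_add)
next
  case (Suc k)
  show ?case
    by (rule Ck_on_has_derivative
        [where F="\<lambda>x v. frechet_derivative f (at x) v + frechet_derivative g (at x) v"])
      (use Suc assms(1) in \<open>auto intro!: has_derivative_add Ck_on_Suc_has_derivative\<close>)
qed

lemma Ck_on_mult:
  fixes f g :: "_ \<Rightarrow> real"
  assumes "open S" "Ck_on k f S" "Ck_on k g S"
  shows "Ck_on k (\<lambda>x. f x * g x) S"
  using assms(2,3)
proof (induction k arbitrary: f g)
  case 0
  then show ?case by (simp add: continuous_on_mult)
next
  case (Suc k)
  show ?case
  proof (rule Ck_on_has_derivative
      [where F="\<lambda>x v. f x * frechet_derivative g (at x) v + frechet_derivative f (at x) v * g x"])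
    show "Ck_on k (\<lambda>x. f x * frechet_derivative g (at x) v
        + frechet_derivative f (at x) v * g x) S" for v
      using Suc.prems Ck_on_SucD[OF Suc.prems(1)] Ck_on_SucD[OF Suc.prems(2)]
      by (intro Ck_on_add Suc.IH assms(1)) auto
  qed (use assms(1) Suc.prems in \<open>auto intro!: has_derivative_mult Ck_on_Suc_has_derivative\<close>)
qed

lemma Ck_on_sum:
  fixes f :: "'i \<Rightarrow> _"
  assumes "open S" "\<And>i. i \<in> I \<Longrightarrow> Ck_on k (f i) S"
  shows "Ck_on k (\<lambda>x. \<Sum>i\<in>I. f i x) S"
  using assms(2)
  by (induction I rule: infinite_finite_induct) (auto intro!: Ck_on_add assms(1))

lemma Ck_on_bounded_linear_comp:
  assumes "bounded_linear L" "open S" "Ck_on k f S"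
  shows "Ck_on k (\<lambda>x. L (f x)) S"
  using assms(3)
proof (induction k arbitrary: f)
  case 0
  then show ?case using assms(1) by (simp add: bounded_linear.continuous_on)
next
  case (Suc k)
  show ?case
    by (rule Ck_on_has_derivative[where F="\<lambda>x v. L (frechet_derivative f (at x) v)"])
      (use Suc assms in \<open>auto intro!: bounded_linear.has_derivative[OF assms(1)]
          Ck_on_Suc_has_derivative\<close>)
qed

text \<open>
  The chain rule writes a directional derivative of \<open>f \<circ> g\<close> as a sum, over a basis of the middle
  space, of products of derivatives of \<open>f\<close> (again composed with \<open>g\<close>) and of \<open>g\<close>, which makes the
  induction on the order work.
\<close>

lemma Ck_on_compose:
  fixes f :: "'b::euclidean_space \<Rightarrow> real" and g :: "'c::real_normed_vector \<Rightarrow> 'b"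
  assumes "open S" "open T" "g ` S \<subseteq> T" "Ck_on k f T" "Ck_on k g S"
  shows "Ck_on k (f \<circ> g) S"
  using assms(4,5)
proof (induction k arbitrary: f)
  case 0
  then show ?case
    using assms(3) by (simp add: continuous_on_compose continuous_on_subset del: o_apply)
next
  case (Suc k)
  let ?f = "\<lambda>x. frechet_derivative f (at x)" and ?g = "\<lambda>x. frechet_derivative g (at x)"
  show ?case
  proof (rule Ck_on_has_derivative[where F="\<lambda>x v. \<Sum>b\<in>Basis. (?g x v \<bullet> b) * (((\<lambda>y. ?f y b) \<circ> g) x)"])
    fix x assume x: "x \<in> S"
    have f: "(f has_derivative ?f (g x)) (at (g x))"
      using Suc.prems x assms(3) by (intro Ck_on_Suc_has_derivative[of k f T]) auto
    have "?f (g x) (?g x v) = (\<Sum>b\<in>Basis. (?g x v \<bullet> b) * ?f (g x) b)" for v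
    proof -
      have l: "linear (?f (g x))" using f has_derivative_linear by blast
      have "?f (g x) (?g x v) = ?f (g x) (\<Sum>b\<in>Basis. (?g x v \<bullet> b) *\<^sub>R b)"
        by (simp add: euclidean_representation)
      then show ?thesis using l by (simp add: linear_sum linear_cmul)
    qed
    then show "((f \<circ> g) has_derivative
        (\<lambda>v. \<Sum>b\<in>Basis. (?g x v \<bullet> b) * ((\<lambda>y. ?f y b) \<circ> g) x)) (at x)"
      using diff_chain_at[OF Ck_on_Suc_has_derivative[OF Suc.prems(2) x] f]
      by (simp add: o_def)
  next
    fix v
    show "Ck_on k (\<lambda>x. \<Sum>b\<in>Basis. (?g x v \<bullet> b) * ((\<lambda>y. ?f y b) \<circ> g) x) S"
      using Suc.prems Ck_on_SucD[OF Suc.prems(2)]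
      by (intro Ck_on_sum Ck_on_mult assms(1) Suc.IH
          Ck_on_bounded_linear_comp[OF bounded_linear_inner_left]) auto
  qed (rule assms(1))
qed

section \<open>Bump functions\<close>

text \<open>
  The functions \<open>exp (-1/t) / t\<^sup>j\<close>, extended by zero to \<open>t \<le> 0\<close>, are closed under
  differentiation up to linear combinations; so all of them are smooth. The case \<open>j = 0\<close> yields bumps.
\<close>

definition flat :: "nat \<Rightarrow> real \<Rightarrow> real"
  where "flat j t = (if t > 0 then exp (- (1 / t)) * (1 / t) ^ j else 0)"

lemma flat_tendsto_0: "((\<lambda>t. exp (- (1 / t)) * (1 / t) ^ j) \<longlongrightarrow> 0) (at_right (0::real))"
proof -
  have "((\<lambda>t. inverse t ^ j / exp (inverse t)) \<longlongrightarrow> 0) (at_right (0::real))"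
    by (rule filterlim_compose[OF tendsto_power_div_exp_0 filterlim_inverse_at_top_right])
  then show ?thesis by (simp add: exp_minus field_simps)
qed

lemma flat_has_derivative:
  "(flat j has_derivative (\<lambda>v. (flat (j + 2) t - real j * flat (Suc j) t) * v)) (at t)"
proof -
  consider "t > 0" | "t < 0" | "t = 0" by linarith
  then have "(flat j has_field_derivative (flat (j + 2) t - real j * flat (Suc j) t)) (at t)"
  proof cases
    case 1
    have "((\<lambda>t. exp (- (1 / t)) * (1 / t) ^ j) has_field_derivative
        (flat (j + 2) t - real j * flat (Suc j) t)) (at t)"
      using 1 unfolding flat_def
      by (cases j) (auto intro!: derivative_eq_intros
          simp: field_simps power2_eq_square power_add,
          metis One_nat_def power_eq_if)
    then show ?thesis
      by (rule has_field_derivative_transform_within_open[where S="{0<..}"])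
        (use 1 in \<open>auto simp: flat_def\<close>)
  next
    case 2
    have "((\<lambda>t. 0) has_field_derivative 0) (at t)" by simp
    then have "(flat j has_field_derivative 0) (at t)"
      by (rule has_field_derivative_transform_within_open[where S="{..<0}"])
        (use 2 in \<open>auto simp: flat_def\<close>)
    then show ?thesis using 2 by (simp add: flat_def)
  next
    case 3
    have "((\<lambda>y. flat j y / y) \<longlongrightarrow> 0) (at_right 0)"
    proof (rule Lim_transform_eventually[OF flat_tendsto_0[of "Suc j"]])
      show "\<forall>\<^sub>F t in at_right 0. exp (- (1 / t)) * (1 / t) ^ Suc j = flat j t / t"
        by (auto simp: eventually_at_right_less flat_def eventually_at intro!: exI[of _ 1])
    qed
    moreover have "((\<lambda>y. flat j y / y) \<longlongrightarrow> 0) (at_left 0)"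
      by (rule Lim_transform_eventually[OF tendsto_const])
        (auto simp: eventually_at flat_def intro!: exI[of _ 1])
    ultimately have "((\<lambda>y. flat j y / y) \<longlongrightarrow> 0) (at 0)"
      by (simp add: filterlim_split_at)
    then show ?thesis using 3 by (simp add: has_field_derivative_iff flat_def)
  qed
  then show ?thesis by (simp only: has_field_derivative_def)
qed

lemma Ck_on_flat: "Ck_on k (flat j) UNIV"
proof (induction k arbitrary: j)
  case 0
  show ?case
    by (auto intro!: continuous_at_imp_continuous_on has_derivative_continuous flat_has_derivative)
next
  case (Suc k)
  have "Ck_on k (\<lambda>t. (flat (j + 2) t + (- real j) * flat (Suc j) t) * v) UNIV" for v
    by (intro Ck_on_mult Ck_on_add Suc Ck_on_const open_UNIV)
  then show ?case
    by (intro Ck_on_has_derivative[OF open_UNIV flat_has_derivative]) simp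
qed

lemma smooth_bump:
  fixes a :: "'e::euclidean_space"
  assumes "r > 0"
  obtains \<rho> :: "'e \<Rightarrow> real" where "smooth_on \<rho> UNIV" "\<rho> a \<noteq> 0" "\<And>x. x \<notin> cball a r \<Longrightarrow> \<rho> x = 0"
proof -
  let ?q = "\<lambda>x. r\<^sup>2 + (-1) * (\<Sum>b\<in>Basis. ((x \<bullet> b) + (- (a \<bullet> b))) * ((x \<bullet> b) + (- (a \<bullet> b))))"
  have q: "?q x = r\<^sup>2 - (dist x a)\<^sup>2" for x
    unfolding dist_norm power2_norm_eq_inner by (subst euclidean_inner) (simp add: inner_diff_left)
  have "Ck_on k ?q UNIV" for k
    by (intro Ck_on_add Ck_on_mult Ck_on_sum Ck_on_const open_UNIV
        Ck_on_bounded_linear[OF bounded_linear_inner_left])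
  then have "smooth_on (flat 0 \<circ> ?q) UNIV"
    unfolding smooth_on_def using Ck_on_compose[OF open_UNIV open_UNIV _ Ck_on_flat] by blast
  moreover have "(flat 0 \<circ> ?q) a \<noteq> 0" using assms by (simp add: flat_def)
  moreover have "(flat 0 \<circ> ?q) x = 0" if "x \<notin> cball a r" for x
  proof -
    have "r < dist x a" using that by (simp add: dist_commute)
    then have "r\<^sup>2 < (dist x a)\<^sup>2" using assms by (simp add: power_strict_mono)
    then show ?thesis by (simp only: o_def q flat_def) simp
  qed
  ultimately show ?thesis using that by blast
qed

section \<open>Smooth functions and vector fields on a manifold\<close>

lemma smooth_on_const: "smooth_on (\<lambda>x. c) S"
  by (simp add: smooth_on_def)

lemma smooth_on_cong:
  "smooth_on f S \<Longrightarrow> open S \<Longrightarrow> (\<And>x. x \<in> S \<Longrightarrow> f x = g x) \<Longrightarrow> smooth_on g S"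
  unfolding smooth_on_def using Ck_on_cong by blast

lemma smooth_on_subset: "smooth_on f S \<Longrightarrow> T \<subseteq> S \<Longrightarrow> smooth_on f T"
  unfolding smooth_on_def using Ck_on_subset by blast

lemma smooth_on_locally:
  assumes "\<And>x. x \<in> S \<Longrightarrow> \<exists>T. open T \<and> x \<in> T \<and> smooth_on f T"
  shows "smooth_on f S"
  unfolding smooth_on_def
proof
  show "Ck_on k f S" for k
    by (rule Ck_on_locally) (use assms in \<open>auto simp: smooth_on_def\<close>)
qed

lemma smooth_on_add:
  "open S \<Longrightarrow> smooth_on f S \<Longrightarrow> smooth_on g S \<Longrightarrow> smooth_on (\<lambda>x. f x + g x) S"
  by (simp add: smooth_on_def Ck_on_add)

lemma smooth_on_mult:
  fixes f g :: "_ \<Rightarrow> real"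
  shows "open S \<Longrightarrow> smooth_on f S \<Longrightarrow> smooth_on g S \<Longrightarrow> smooth_on (\<lambda>x. f x * g x) S"
  by (simp add: smooth_on_def Ck_on_mult)

lemma smooth_on_compose:
  fixes f :: "'b::euclidean_space \<Rightarrow> real" and g :: "'c::real_normed_vector \<Rightarrow> 'b"
  assumes "smooth_on f T" "smooth_on g S" "open S" "open T" "g ` S \<subseteq> T"
  shows "smooth_on (f \<circ> g) S"
  using assms Ck_on_compose unfolding smooth_on_def by blast

lemma smooth_on_has_derivative:
  "smooth_on f S \<Longrightarrow> x \<in> S \<Longrightarrow> (f has_derivative frechet_derivative f (at x)) (at x)"
  unfolding smooth_on_def using Ck_on_Suc_has_derivative by blast

lemma smooth_on_frechet_derivative:
  "smooth_on f S \<Longrightarrow> smooth_on (\<lambda>x. frechet_derivative f (at x) v) S"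
  unfolding smooth_on_def using Ck_on.simps(2) by blast

lemma smooth_on_inner: "open S \<Longrightarrow> smooth_on (\<lambda>x. (x - a) \<bullet> v) S"
  unfolding smooth_on_def inner_diff_left
  unfolding diff_conv_add_uminus
  by (intro allI Ck_on_add Ck_on_const Ck_on_bounded_linear[OF bounded_linear_inner_left])

lemma chart_openD: "chart (U, x) \<Longrightarrow> open U" "chart (U, x) \<Longrightarrow> open (x ` U)"
  by (auto simp: chart_def)

lemma chart_open_image:
  assumes "chart (U, x)" "open S"
  shows "open (x ` (U \<inter> S))"
proof -
  have h: "homeomorphism U (x ` U) x (inv_into U x)" "open (x ` U)"
    using assms by (auto simp: chart_def)
  have "x ` (U \<inter> S) = x ` U \<inter> inv_into U x -` S"
    using h(1) unfolding homeomorphism_def by force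
  then show ?thesis
    using h assms(2) by (metis continuous_open_preimage homeomorphism_def)
qed

lemma chart_inv: "chart (U, x) \<Longrightarrow> p \<in> U \<Longrightarrow> inv_into U x (x p) = p"
  by (auto simp: chart_def homeomorphism_def)

context
  fixes A :: "('a::{t2_space, second_countable_topology}, 'e::euclidean_space) atlas"
  assumes A: "smooth_atlas A"
begin

lemma atlas_chart: "c \<in> A \<Longrightarrow> chart c"
  using A by (auto simp: smooth_atlas_def)

lemma smooth_functions_const: "(\<lambda>p. c) \<in> smooth_functions A"
  by (auto simp: smooth_functions_def o_def smooth_on_const)

lemma smooth_functions_add:
  "u \<in> smooth_functions A \<Longrightarrow> v \<in> smooth_functions A \<Longrightarrow> u + v \<in> smooth_functions A"
  using chart_openD(2)[OF atlas_chart] unfolding smooth_functions_def o_def plus_fun_def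
  by (auto intro!: smooth_on_add)

lemma smooth_functions_mult:
  "u \<in> smooth_functions A \<Longrightarrow> v \<in> smooth_functions A \<Longrightarrow> u * v \<in> smooth_functions A"
  using chart_openD(2)[OF atlas_chart] unfolding smooth_functions_def o_def times_fun_def
  by (auto intro!: smooth_on_mult)

text \<open>
  A function that vanishes off a compact part of a chart domain extends by zero: that compact
  set is closed because the manifold is Hausdorff, so near a point outside it the extension is \<open>0\<close>.
\<close>

lemma extend_by_zero:
  fixes F :: "'e \<Rightarrow> real"
  assumes c: "(U, x) \<in> A" and F: "smooth_on F (x ` U)"
    and C: "compact C" "C \<subseteq> x ` U" "\<And>y. y \<in> x ` U - C \<Longrightarrow> F y = 0"
  shows "(\<lambda>q. if q \<in> U then F (x q) else 0) \<in> smooth_functions A" (is "?f \<in> _")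
  unfolding smooth_functions_def
proof safe
  fix W y assume d: "(W, y) \<in> A"
  note cU = atlas_chart[OF c] and cW = atlas_chart[OF d]
  let ?K = "inv_into U x ` C"
  have hU: "homeomorphism U (x ` U) x (inv_into U x)" using cU by (simp add: chart_def)
  then have "compact ?K"
    using C(1,2) by (metis compact_continuous_image continuous_on_subset homeomorphism_def)
  then have K: "open (- ?K)" by (simp add: compact_imp_closed open_Compl)
  have f0: "?f q = 0" if "q \<notin> ?K" for q
  proof (cases "q \<in> U")
    case True
    then have "x q \<notin> C" using that chart_inv[OF cU True] by (metis imageI)
    then show ?thesis using C(3)[of "x q"] True by simp
  qed simp
  have off: "smooth_on (?f \<circ> inv_into W y) (y ` (W \<inter> - ?K))"
  proof (rule smooth_on_cong[OF smooth_on_const chart_open_image[OF cW K]])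
    fix z assume "z \<in> y ` (W \<inter> - ?K)"
    then obtain q where q: "q \<in> W" "q \<notin> ?K" "z = y q" by blast
    show "0 = (?f \<circ> inv_into W y) z"
      unfolding q(3) o_apply chart_inv[OF cW q(1)] using f0[OF q(2)] by (rule sym)
  qed
  have on: "smooth_on (?f \<circ> inv_into W y) (y ` (W \<inter> U))"
  proof (rule smooth_on_cong)
    show o: "open (y ` (W \<inter> U))" by (rule chart_open_image[OF cW chart_openD(1)[OF cU]])
    have "smooth_on (x \<circ> inv_into W y) (y ` (W \<inter> U))"
      using A c d unfolding smooth_atlas_def by blast
    then show "smooth_on (F \<circ> (x \<circ> inv_into W y)) (y ` (W \<inter> U))"
      using F o chart_openD(2)[OF cU] chart_inv[OF cW]
      by (intro smooth_on_compose[where T="x ` U"]) auto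
  qed (use chart_inv[OF cW] in auto)
  have "?K \<subseteq> U" using C(2) hU by (auto simp: homeomorphism_def)
  then have cover: "z \<in> y ` (W \<inter> - ?K) \<or> z \<in> y ` (W \<inter> U)" if "z \<in> y ` W" for z
    using that by blast
  show "smooth_on (?f \<circ> inv_into W y) (y ` W)"
  proof (rule smooth_on_locally)
    fix z assume "z \<in> y ` W"
    from cover[OF this] show "\<exists>T. open T \<and> z \<in> T \<and> smooth_on (?f \<circ> inv_into W y) T"
    proof
      assume "z \<in> y ` (W \<inter> - ?K)"
      then show ?thesis using off chart_open_image[OF cW K] by (intro exI conjI)
    next
      assume "z \<in> y ` (W \<inter> U)"
      then show ?thesis using on chart_open_image[OF cW chart_openD(1)[OF cU]] by (intro exI conjI)
    qed
  qed
qed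

lemma vector_field_smooth: "X \<in> vector_fields A \<Longrightarrow> u \<in> smooth_functions A \<Longrightarrow> X u \<in> smooth_functions A"
  by (simp add: vector_fields_def)

lemma vector_field_nonsmooth: "X \<in> vector_fields A \<Longrightarrow> u \<notin> smooth_functions A \<Longrightarrow> X u = 0"
  by (simp add: vector_fields_def)

lemma vector_field_linear:
  "X \<in> vector_fields A \<Longrightarrow> u \<in> smooth_functions A \<Longrightarrow> v \<in> smooth_functions A \<Longrightarrow>
    X (\<lambda>p. a * u p + b * v p) = (\<lambda>p. a * X u p + b * X v p)"
  by (simp add: vector_fields_def)

lemma vector_field_product:
  "X \<in> vector_fields A \<Longrightarrow> u \<in> smooth_functions A \<Longrightarrow> v \<in> smooth_functions A \<Longrightarrow>
    X (u * v) = u * X v + v * X u"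
  by (simp add: vector_fields_def)

lemma vector_field_add:
  assumes "X \<in> vector_fields A" "u \<in> smooth_functions A" "v \<in> smooth_functions A"
  shows "X (u + v) = X u + X v"
  using vector_field_linear[OF assms, of 1 1] by (simp add: plus_fun_def)

lemma vector_field_const:
  assumes X: "X \<in> vector_fields A"
  shows "X (\<lambda>p. c) = 0"
proof -
  have o: "(\<lambda>p. 1) \<in> smooth_functions A" by (rule smooth_functions_const)
  have "X 1 = X 1 + X 1"
    using vector_field_product[OF X o o] by (simp flip: one_fun_def)
  then have "X (\<lambda>p. 1) = 0" by (simp flip: one_fun_def)
  then show ?thesis
    using vector_field_linear[OF X o o, of c 0] by (simp add: zero_fun_def)
qed

lemma vector_fields_plus:
  assumes X: "X \<in> vector_fields A" and Y: "Y \<in> vector_fields A"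
  shows "X + Y \<in> vector_fields A"
  using X Y unfolding vector_fields_def
  by (auto simp: smooth_functions_add fun_eq_iff algebra_simps)

lemma vector_fields_scale:
  assumes u: "u \<in> smooth_functions A" and X: "X \<in> vector_fields A"
  shows "u \<odot> X \<in> vector_fields A"
  using u X unfolding vector_fields_def scale_def
  by (auto simp: smooth_functions_mult fun_eq_iff algebra_simps)

lemma vector_fields_uminus:
  assumes X: "X \<in> vector_fields A"
  shows "- X \<in> vector_fields A"
proof -
  have "- X = (\<lambda>p. -1) \<odot> X" by (simp add: scale_def fun_eq_iff)
  then show ?thesis using vector_fields_scale[OF smooth_functions_const X] by simp
qed

lemma vector_fields_diff:
  "X \<in> vector_fields A \<Longrightarrow> Y \<in> vector_fields A \<Longrightarrow> X - Y \<in> vector_fields A"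
  using vector_fields_plus vector_fields_uminus by (metis diff_conv_add_uminus)

lemma vector_fields_lie_bracket:
  assumes X: "X \<in> vector_fields A" and Y: "Y \<in> vector_fields A"
  shows "lie_bracket X Y \<in> vector_fields A"
proof -
  have z: "X 0 = 0" "Y 0 = 0" using vector_field_const X Y by (auto simp: zero_fun_def)
  have sub: "X u - Y v \<in> smooth_functions A"
    if "X u \<in> smooth_functions A" "Y v \<in> smooth_functions A" for u v
  proof -
    have e: "X u - Y v = X u + (\<lambda>p. -1) * Y v" by (simp add: fun_eq_iff)
    show ?thesis
      unfolding e
      by (rule smooth_functions_add[OF that(1) smooth_functions_mult[OF smooth_functions_const that(2)]])
  qed
  show ?thesis
    unfolding vector_fields_def lie_bracket_def mem_Collect_eq
  proof (intro conjI ballI allI impI)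
    fix u assume u: "u \<in> smooth_functions A"
    note Xu = vector_field_smooth[OF X u] and Yu = vector_field_smooth[OF Y u]
    show "X (Y u) - Y (X u) \<in> smooth_functions A"
      using vector_field_smooth X Y Xu Yu sub by blast
    fix v assume v: "v \<in> smooth_functions A"
    note Xv = vector_field_smooth[OF X v] and Yv = vector_field_smooth[OF Y v]
    show "X (Y (u * v)) - Y (X (u * v)) = u * (X (Y v) - Y (X v)) + v * (X (Y u) - Y (X u))"
      unfolding vector_field_product[OF X u v] vector_field_product[OF Y u v]
        vector_field_add[OF X smooth_functions_mult[OF u Yv] smooth_functions_mult[OF v Yu]]
        vector_field_add[OF Y smooth_functions_mult[OF u Xv] smooth_functions_mult[OF v Xu]]
        vector_field_product[OF X u Yv] vector_field_product[OF X v Yu]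
        vector_field_product[OF Y u Xv] vector_field_product[OF Y v Xu]
      by (simp add: algebra_simps)
    fix a b
    show "X (Y (\<lambda>p. a * u p + b * v p)) - Y (X (\<lambda>p. a * u p + b * v p))
        = (\<lambda>p. a * (X (Y u) - Y (X u)) p + b * (X (Y v) - Y (X v)) p)"
      unfolding vector_field_linear[OF X u v] vector_field_linear[OF Y u v]
        vector_field_linear[OF X Yu Yv] vector_field_linear[OF Y Xu Xv]
      by (simp add: fun_eq_iff algebra_simps)
  qed (simp add: z vector_field_nonsmooth[OF X] vector_field_nonsmooth[OF Y])
qed

text \<open>
  Multiplying a coordinate vector field by a bump function makes it a global vector field.
  These fields span the tangent space at the centre \<open>p\<close> of the bump: the linear coordinate
  functions, centred at \<open>p\<close> and multiplied by the bump, tell them apart.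
\<close>

lemma vector_fields_spanning:
  obtains E :: "'e \<Rightarrow> 'a vfield" where
    "\<And>v. E v \<in> vector_fields A" "\<And>v w. E (v + w) = E v + E w"
    "\<And>c v. E (c *\<^sub>R v) = (\<lambda>p. c) \<odot> E v" "\<And>v. vanishes_at (E v) p \<Longrightarrow> v = 0"
proof -
  have "p \<in> (\<Union>(U, x)\<in>A. U)" using A unfolding smooth_atlas_def by blast
  then obtain U x where c: "(U, x) \<in> A" and p: "p \<in> U" by blast
  note cU = atlas_chart[OF c]
  have oU: "open (x ` U)" by (rule chart_openD(2)[OF cU])
  obtain r where r: "r > 0" "cball (x p) r \<subseteq> x ` U" using oU p open_contains_cball by blast
  obtain \<rho> :: "'e \<Rightarrow> real" where \<rho>: "smooth_on \<rho> UNIV" "\<rho> (x p) \<noteq> 0" "\<And>y. y \<notin> cball (x p) r \<Longrightarrow> \<rho> y = 0"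
    using smooth_bump[OF r(1)] by blast
  have \<rho>U: "smooth_on \<rho> (x ` U)" using \<rho>(1) smooth_on_subset by blast
  let ?i = "inv_into U x"
  let ?d = "\<lambda>u q v. frechet_derivative (u \<circ> ?i) (at q) v"
  define E where "E v u = (\<lambda>q. if u \<in> smooth_functions A \<and> q \<in> U then \<rho> (x q) * ?d u (x q) v else 0)"
    for v :: 'e and u :: "'a \<Rightarrow> real"
  have ext: "(\<lambda>q. if q \<in> U then \<rho> (x q) * F (x q) else 0) \<in> smooth_functions A"
    if "smooth_on F (x ` U)" for F
    by (rule extend_by_zero[OF c _ compact_cball r(2)])
      (use that \<rho>U oU \<rho>(3) in \<open>auto intro: smooth_on_mult\<close>)
  have sm: "smooth_on (u \<circ> ?i) (x ` U)" if "u \<in> smooth_functions A" for u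
    using that c unfolding smooth_functions_def by blast
  have der: "(u \<circ> ?i has_derivative ?d u (x q)) (at (x q))"
    if "u \<in> smooth_functions A" "q \<in> U" for u q
    using smooth_on_has_derivative[OF sm[OF that(1)]] that(2) by blast
  have lin: "linear (?d u (x q))" if "u \<in> smooth_functions A" "q \<in> U" for u q
    using der[OF that] has_derivative_linear by blast
  have der_eq: "?d u (x q) = G" if "(u \<circ> ?i has_derivative G) (at (x q))" for u q G
    using frechet_derivative_at[OF that] by simp
  show ?thesis
  proof (rule that)
    show "E (v + w) = E v + E w" for v w
      by (auto simp: E_def fun_eq_iff linear_add[OF lin] algebra_simps)
    show "E (a *\<^sub>R v) = (\<lambda>p. a) \<odot> E v" for a v
      by (auto simp: E_def scale_def fun_eq_iff linear_cmul[OF lin] algebra_simps)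
    show "E v \<in> vector_fields A" for v
      unfolding vector_fields_def mem_Collect_eq
    proof (intro conjI ballI allI impI)
      fix u assume u: "u \<in> smooth_functions A"
      show "E v u \<in> smooth_functions A"
        using ext[OF smooth_on_frechet_derivative[OF sm[OF u]], of v] u by (simp add: E_def)
      fix w assume w: "w \<in> smooth_functions A"
      have "?d (u * w) (x q) v = u q * ?d w (x q) v + w q * ?d u (x q) v" if q: "q \<in> U" for q
      proof -
        have "(u * w) \<circ> ?i = (\<lambda>y. (u \<circ> ?i) y * (w \<circ> ?i) y)" by (simp add: fun_eq_iff)
        then have "?d (u * w) (x q) = (\<lambda>h. (u \<circ> ?i) (x q) * ?d w (x q) h + ?d u (x q) h * (w \<circ> ?i) (x q))"
          using has_derivative_mult[OF der[OF u q] der[OF w q]] by (intro der_eq) simp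
        then show ?thesis using chart_inv[OF cU q] by simp
      qed
      then show "E v (u * w) = u * E v w + w * E v u"
        using u w smooth_functions_mult[OF u w] by (auto simp: E_def fun_eq_iff algebra_simps)
      fix a b
      have uw: "(\<lambda>p. a * u p + b * w p) \<in> smooth_functions A"
        using smooth_functions_add[OF smooth_functions_mult[OF smooth_functions_const u]
            smooth_functions_mult[OF smooth_functions_const w], of a b]
        by (simp add: plus_fun_def times_fun_def)
      have "?d (\<lambda>p. a * u p + b * w p) (x q) v = a * ?d u (x q) v + b * ?d w (x q) v" if q: "q \<in> U" for q
      proof -
        have "(\<lambda>p. a * u p + b * w p) \<circ> ?i = (\<lambda>y. a * (u \<circ> ?i) y + b * (w \<circ> ?i) y)"
          by (simp add: fun_eq_iff)
        then have "?d (\<lambda>p. a * u p + b * w p) (x q) = (\<lambda>h. a * ?d u (x q) h + b * ?d w (x q) h)"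
          using has_derivative_add[OF has_derivative_mult_right[OF der[OF u q], of a]
              has_derivative_mult_right[OF der[OF w q], of b]]
          by (intro der_eq) simp
        then show ?thesis by simp
      qed
      then show "E v (\<lambda>p. a * u p + b * w p) = (\<lambda>p. a * E v u p + b * E v w p)"
        using u w uw by (auto simp: E_def fun_eq_iff algebra_simps)
    qed (auto simp: E_def)
    fix v assume v: "vanishes_at (E v) p"
    define u where "u = (\<lambda>q. if q \<in> U then \<rho> (x q) * ((x q - x p) \<bullet> v) else 0)"
    have u: "u \<in> smooth_functions A" unfolding u_def by (rule ext[OF smooth_on_inner[OF oU]])
    have "((\<lambda>y. \<rho> y * ((y - x p) \<bullet> v)) has_derivative (\<lambda>h. \<rho> (x p) * (h \<bullet> v))) (at (x p))"
      using smooth_on_has_derivative[OF \<rho>(1), of "x p"]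
      by (auto intro!: derivative_eq_intros)
    then have "(u \<circ> ?i has_derivative (\<lambda>h. \<rho> (x p) * (h \<bullet> v))) (at (x p))"
      by (rule has_derivative_transform_within_open[OF _ oU])
        (use p chart_inv[OF cU] in \<open>auto simp: u_def\<close>)
    then have "E v u p = \<rho> (x p) * (\<rho> (x p) * (v \<bullet> v))"
      using u p by (simp add: E_def der_eq)
    then show "v = 0" using v \<rho>(2) by (simp add: vanishes_at_def)
  qed
qed

end

text \<open>
  A dimension count: \<open>n\<close> linear conditions cannot exhaust a tangent space of larger dimension.
\<close>

lemma orthogonal_vector_field_exists:
  fixes A :: "('a::{t2_space, second_countable_topology}, 'e::euclidean_space) atlas"
  assumes A: "smooth_atlas A" and g: "riemannian_metric A g"
    and S: "finite S" "S \<subseteq> vector_fields A" "card S < DIM('e)"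
  obtains Y where "Y \<in> vector_fields A" "g Y Y p \<noteq> 0" "\<And>X. X \<in> S \<Longrightarrow> g X Y p = 0"
proof -
  obtain E :: "'e \<Rightarrow> 'a vfield" where E: "\<And>v. E v \<in> vector_fields A" "\<And>v w. E (v + w) = E v + E w"
    "\<And>c v. E (c *\<^sub>R v) = (\<lambda>p. c) \<odot> E v" "\<And>v. vanishes_at (E v) p \<Longrightarrow> v = 0"
    using vector_fields_spanning[OF A] by blast
  have form: "one_form A (g X)" if "X \<in> S" for X using that g S(2) by (auto simp: riemannian_metric_def)
  have lin: "linear (\<lambda>v. g X (E v) p)" if "X \<in> S" for X
    using form[OF that] E(1) smooth_functions_const[OF A]
    by (intro linearI) (auto simp: E(2,3) one_form_def)
  define w where "w X = (\<Sum>b\<in>Basis. g X (E b) p *\<^sub>R b)" for X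
  have w: "g X (E v) p = v \<bullet> w X" if "X \<in> S" for X v
    using linear_sum[OF lin[OF that], of "\<lambda>b. (v \<bullet> b) *\<^sub>R b" Basis] linear_cmul[OF lin[OF that]]
    by (simp add: euclidean_representation w_def inner_sum_right mult.commute)
  have "dim (span (w ` S)) < DIM('e)"
    using S card_image_le[OF S(1), of w] dim_le_card'[of "w ` S"] by (simp add: dim_span)
  then obtain v where v: "v \<noteq> 0" "\<And>y. y \<in> span (w ` S) \<Longrightarrow> orthogonal v y"
    using orthogonal_to_subspace_exists[of "w ` S"] by (metis dim_span)
  show ?thesis
  proof (rule that[OF E(1)[of v]])
    show "g (E v) (E v) p \<noteq> 0" using g E(1,4) v(1) unfolding riemannian_metric_def by blast
    show "g X (E v) p = 0" if "X \<in> S" for X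
      using v(2)[of "w X"] that w[OF that, of v] by (simp add: orthogonal_def span_base)
  qed
qed

section \<open>Almost Kenmotsu manifolds\<close>

locale almost_kenmotsu =
  fixes A :: "('a::{t2_space, second_countable_topology}, 'e::euclidean_space) atlas"
    and \<phi> :: "'a vfield \<Rightarrow> 'a vfield" and \<xi> :: "'a vfield" and \<eta> :: "'a vfield \<Rightarrow> 'a \<Rightarrow> real"
    and g :: "'a vfield \<Rightarrow> 'a vfield \<Rightarrow> 'a \<Rightarrow> real" and D :: "'a vfield \<Rightarrow> 'a vfield \<Rightarrow> 'a vfield"
  assumes almost_kenmotsu: "almost_kenmotsu_manifold A \<phi> \<xi> \<eta> g"
    and levi_civita: "levi_civita A g D"
begin

abbreviation V :: "'a vfield set" where "V \<equiv> vector_fields A"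
abbreviation F :: "('a \<Rightarrow> real) set" where "F \<equiv> smooth_functions A"

lemma acm: "almost_contact_metric_manifold A \<phi> \<xi> \<eta> g"
  using almost_kenmotsu by (simp add: almost_kenmotsu_manifold_def)

lemma atlas: "smooth_atlas A" and metric: "riemannian_metric A g" and tensor_phi: "tensor_field_11 A \<phi>"
  and xi_V [simp]: "\<xi> \<in> V" and form_eta: "one_form A \<eta>" and eta_xi [simp]: "\<eta> \<xi> = 1"
  and phi_phi [simp]: "X \<in> V \<Longrightarrow> \<phi> (\<phi> X) = - X + \<eta> X \<odot> \<xi>"
  and g_phi_phi: "X \<in> V \<Longrightarrow> Y \<in> V \<Longrightarrow> g (\<phi> X) (\<phi> Y) = g X Y - \<eta> X * \<eta> Y"
  using acm by (auto simp: almost_contact_metric_manifold_def)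

lemmas V_plus [simp] = vector_fields_plus[OF atlas]
  and V_uminus [simp] = vector_fields_uminus[OF atlas]
  and V_diff [simp] = vector_fields_diff[OF atlas]
  and V_scale [simp] = vector_fields_scale[OF atlas]
  and V_bracket [simp] = vector_fields_lie_bracket[OF atlas]
  and F_const [simp] = smooth_functions_const[OF atlas]
  and F_add [simp] = smooth_functions_add[OF atlas]
  and F_mult [simp] = smooth_functions_mult[OF atlas]

lemma F_consts [simp]: "0 \<in> F" "1 \<in> F" "2 \<in> F"
proof -
  show "0 \<in> F" "1 \<in> F" using F_const[of 0] F_const[of 1] by (auto simp: zero_fun_def one_fun_def)
  then show "2 \<in> F" using F_add[of 1 1] by simp
qed

lemma F_uminus [simp]: "u \<in> F \<Longrightarrow> - u \<in> F"
  using F_mult[OF F_const[of "-1"], of u] by (simp add: times_fun_def fun_Compl_def)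

lemma F_diff [simp]: "u \<in> F \<Longrightarrow> v \<in> F \<Longrightarrow> u - v \<in> F"
  using F_add[of u "- v"] by simp

lemma V_zero [simp]: "0 \<in> V"
  using V_diff[OF xi_V xi_V] by simp

lemma V_apply: "X \<in> V \<Longrightarrow> u \<in> F \<Longrightarrow> X u \<in> F"
  by (rule vector_field_smooth[OF atlas])

lemma two_apply [simp]: "(2 :: 'a \<Rightarrow> real) p = 2"
proof -
  have "(2 :: 'a \<Rightarrow> real) p = (1 + 1 :: 'a \<Rightarrow> real) p" by (simp only: one_add_one)
  then show ?thesis by simp
qed

lemma scale_simps: "u \<odot> (X + Y) = u \<odot> X + u \<odot> Y" "u \<odot> (X - Y) = u \<odot> X - u \<odot> Y" "u \<odot> (- X) = - (u \<odot> X)"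
  "(u + v) \<odot> X = u \<odot> X + v \<odot> X" "(u - v) \<odot> X = u \<odot> X - v \<odot> X" "(- u) \<odot> X = - (u \<odot> X)"
  "u \<odot> (v \<odot> X) = (u * v) \<odot> X"
  for X Y :: "'a vfield"
  by (auto simp: scale_def fun_eq_iff algebra_simps)

lemma scale_const [simp]: "0 \<odot> X = 0" "1 \<odot> X = X" "u \<odot> 0 = 0" for X :: "'a vfield"
  by (auto simp: scale_def fun_eq_iff)

lemma one_form_simps:
  assumes "one_form A \<omega>"
  shows "X \<in> V \<Longrightarrow> \<omega> X \<in> F" "X \<in> V \<Longrightarrow> Y \<in> V \<Longrightarrow> \<omega> (X + Y) = \<omega> X + \<omega> Y"
    "u \<in> F \<Longrightarrow> X \<in> V \<Longrightarrow> \<omega> (u \<odot> X) = u * \<omega> X"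
    "X \<in> V \<Longrightarrow> \<omega> (- X) = - \<omega> X" "\<omega> 0 = 0" "X \<in> V \<Longrightarrow> Y \<in> V \<Longrightarrow> \<omega> (X - Y) = \<omega> X - \<omega> Y"
proof -
  show s: "\<omega> X \<in> F" if "X \<in> V" for X using that assms by (simp add: one_form_def)
  show a: "\<omega> (X + Y) = \<omega> X + \<omega> Y" if "X \<in> V" "Y \<in> V" for X Y using that assms by (simp add: one_form_def)
  show m: "\<omega> (u \<odot> X) = u * \<omega> X" if "u \<in> F" "X \<in> V" for u X using that assms by (simp add: one_form_def)
  show z: "\<omega> 0 = 0" using m[of 0 0] by simp
  show n: "\<omega> (- X) = - \<omega> X" if "X \<in> V" for X
    using a[of X "- X"] that z by (simp add: minus_unique)
  show "\<omega> (X - Y) = \<omega> X - \<omega> Y" if "X \<in> V" "Y \<in> V" for X Y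
    using a[of X "- Y"] n[of Y] that by simp
qed

lemma tensor_simps:
  assumes "tensor_field_11 A T"
  shows "X \<in> V \<Longrightarrow> T X \<in> V" "X \<in> V \<Longrightarrow> Y \<in> V \<Longrightarrow> T (X + Y) = T X + T Y"
    "u \<in> F \<Longrightarrow> X \<in> V \<Longrightarrow> T (u \<odot> X) = u \<odot> T X"
    "X \<in> V \<Longrightarrow> T (- X) = - T X" "T 0 = 0" "X \<in> V \<Longrightarrow> Y \<in> V \<Longrightarrow> T (X - Y) = T X - T Y"
proof -
  show s: "T X \<in> V" if "X \<in> V" for X using that assms by (simp add: tensor_field_11_def)
  show a: "T (X + Y) = T X + T Y" if "X \<in> V" "Y \<in> V" for X Y using that assms by (simp add: tensor_field_11_def)
  show m: "T (u \<odot> X) = u \<odot> T X" if "u \<in> F" "X \<in> V" for u X using that assms by (simp add: tensor_field_11_def)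
  show z: "T 0 = 0" using m[of 0 0] by simp
  show n: "T (- X) = - T X" if "X \<in> V" for X
    using a[of X "- X"] that z by (simp add: minus_unique)
  show "T (X - Y) = T X - T Y" if "X \<in> V" "Y \<in> V" for X Y
    using a[of X "- Y"] n[of Y] that by simp
qed

lemmas eta_simps [simp] = one_form_simps[OF form_eta]
lemmas phi_simps [simp] = tensor_simps[OF tensor_phi]

lemma g_sym: "X \<in> V \<Longrightarrow> Y \<in> V \<Longrightarrow> g X Y = g Y X"
  using metric by (simp add: riemannian_metric_def)

lemma form_g: "X \<in> V \<Longrightarrow> one_form A (g X)"
  using metric by (simp add: riemannian_metric_def)

lemmas g_right [simp] = one_form_simps[OF form_g]

lemma form_g_left: "Y \<in> V \<Longrightarrow> one_form A (\<lambda>X. g X Y)"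
  unfolding one_form_def by (auto simp: g_sym[of _ Y])

lemmas g_left [simp] = one_form_simps(2-6)[OF form_g_left]

lemma g_nonneg: "X \<in> V \<Longrightarrow> g X X p \<ge> 0"
  using metric by (simp add: riemannian_metric_def)

text \<open>A field orthogonal to all fields is orthogonal to itself, hence vanishes at every point.\<close>

lemma V_eqI:
  assumes "X \<in> V" "Y \<in> V" "\<And>Z p. Z \<in> V \<Longrightarrow> g X Z p = g Y Z p"
  shows "X = Y"
proof -
  have "g (X - Y) (X - Y) p = 0" for p
    using assms(3)[of "X - Y" p] assms(1,2) by simp
  then have "vanishes_at (X - Y) p" for p
    using metric assms(1,2) V_diff unfolding riemannian_metric_def by blast
  then show ?thesis by (auto simp: vanishes_at_def fun_eq_iff)
qed

lemma D_tensor: "Y \<in> V \<Longrightarrow> tensor_field_11 A (\<lambda>X. D X Y)"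
  using levi_civita by (simp add: levi_civita_def affine_connection_def)

lemmas D_left [simp] = tensor_simps[OF D_tensor]

lemma D_right [simp]:
  assumes "X \<in> V"
  shows "Y \<in> V \<Longrightarrow> Z \<in> V \<Longrightarrow> D X (Y + Z) = D X Y + D X Z"
    "u \<in> F \<Longrightarrow> Y \<in> V \<Longrightarrow> D X (u \<odot> Y) = X u \<odot> Y + u \<odot> D X Y"
    "Y \<in> V \<Longrightarrow> D X (- Y) = - D X Y" "D X 0 = 0" "Y \<in> V \<Longrightarrow> Z \<in> V \<Longrightarrow> D X (Y - Z) = D X Y - D X Z"
proof -
  show a: "D X (Y + Z) = D X Y + D X Z" if "Y \<in> V" "Z \<in> V" for Y Z
    using that assms levi_civita by (simp add: levi_civita_def affine_connection_def)
  show "D X (u \<odot> Y) = X u \<odot> Y + u \<odot> D X Y" if "u \<in> F" "Y \<in> V" for u Y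
    using that assms levi_civita by (simp add: levi_civita_def affine_connection_def)
  show z: "D X 0 = 0" using a[of 0 0] by simp
  show n: "D X (- Y) = - D X Y" if "Y \<in> V" for Y
    using a[of Y "- Y"] that z by (simp add: minus_unique)
  show "D X (Y - Z) = D X Y - D X Z" if "Y \<in> V" "Z \<in> V" for Y Z
    using a[of Y "- Z"] n[of Z] that by simp
qed

lemma torsion: "X \<in> V \<Longrightarrow> Y \<in> V \<Longrightarrow> lie_bracket X Y = D X Y - D Y X"
  using levi_civita by (simp add: levi_civita_def)

lemma D_metric: "X \<in> V \<Longrightarrow> Y \<in> V \<Longrightarrow> Z \<in> V \<Longrightarrow> X (g Y Z) = g (D X Y) Z + g Y (D X Z)"
  using levi_civita unfolding levi_civita_def by blast

lemma V_apply_add: "X \<in> V \<Longrightarrow> u \<in> F \<Longrightarrow> v \<in> F \<Longrightarrow> X (u + v) = X u + X v"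
  by (rule vector_field_add[OF atlas])

lemma V_apply_0: "X \<in> V \<Longrightarrow> X 0 = 0" and V_apply_1: "X \<in> V \<Longrightarrow> X 1 = 0"
  using vector_field_const[OF atlas, of X 0] vector_field_const[OF atlas, of X 1]
  by (auto simp: zero_fun_def one_fun_def)

lemma V_apply_uminus: "X \<in> V \<Longrightarrow> u \<in> F \<Longrightarrow> X (- u) = - X u"
  using V_apply_add[of X u "- u"] V_apply_0[of X] by (simp add: minus_unique)

lemma phi_xi [simp]: "\<phi> \<xi> = 0"
proof -
  define a where "a = \<eta> (\<phi> \<xi>)"
  have a: "a \<in> F" by (simp add: a_def)
  have 1: "\<phi> (\<phi> \<xi>) = 0" by simp
  have "\<phi> (\<phi> (\<phi> \<xi>)) = - \<phi> \<xi> + a \<odot> \<xi>" unfolding a_def by (rule phi_phi) simp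
  then have e: "\<phi> \<xi> = a \<odot> \<xi>" by (simp add: 1)
  have "\<phi> (\<phi> \<xi>) = (a * a) \<odot> \<xi>" by (simp add: e a scale_simps)
  then have "\<eta> ((a * a) \<odot> \<xi>) = 0" using 1 by (metis eta_simps(5))
  then have "a = 0" using a by (auto simp: fun_eq_iff)
  then show ?thesis using e by simp
qed

lemma g_xi_right [simp]: "X \<in> V \<Longrightarrow> g X \<xi> = \<eta> X"
  using g_phi_phi[of X \<xi>] by (simp add: fun_eq_iff)

lemma g_xi_left [simp]: "X \<in> V \<Longrightarrow> g \<xi> X = \<eta> X"
  using g_sym[of X \<xi>] by simp

lemma eta_phi [simp]: "X \<in> V \<Longrightarrow> \<eta> (\<phi> X) = 0"
proof -
  assume X: "X \<in> V"
  have "- \<phi> X = \<phi> (\<phi> (\<phi> X))" using X by (subst phi_phi) simp_all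
  also have "\<dots> = - \<phi> X + \<eta> (\<phi> X) \<odot> \<xi>" using X by (intro phi_phi) simp
  finally have "\<eta> (\<phi> X) \<odot> \<xi> = 0" by (metis add_cancel_left_right)
  then have "\<eta> (\<eta> (\<phi> X) \<odot> \<xi>) = 0" by (metis eta_simps(5))
  then show ?thesis using X by simp
qed

lemma g_phi [simp]: "X \<in> V \<Longrightarrow> Y \<in> V \<Longrightarrow> g (\<phi> X) Y = - g X (\<phi> Y)"
  using g_phi_phi[of X "\<phi> Y"] by (simp add: fun_eq_iff) (metis minus_minus)

text \<open>
  On sections of \<open>ker \<eta>\<close> this is, up to sign, the shape operator of the leaves, and its symmetry is the equation \<open>d\<eta> = 0\<close>.
\<close>

definition B :: "'a vfield \<Rightarrow> 'a vfield" where "B X = D X \<xi>"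

lemma tensor_B: "tensor_field_11 A B"
  unfolding B_def[abs_def] by (rule D_tensor) simp

lemmas B_simps [simp] = tensor_simps[OF tensor_B]

lemma D_xi [simp]: "D X \<xi> = B X" by (simp add: B_def)

lemma D_eta: "X \<in> V \<Longrightarrow> Y \<in> V \<Longrightarrow> X (\<eta> Y) = \<eta> (D X Y) + g Y (B X)"
  using D_metric[of X Y \<xi>] by simp

lemma eta_B [simp]: "X \<in> V \<Longrightarrow> \<eta> (B X) = 0"
  using D_metric[of X \<xi> \<xi>] V_apply_1[of X] by (simp add: fun_eq_iff)

lemma g_B [simp]: "X \<in> V \<Longrightarrow> Y \<in> V \<Longrightarrow> g (B X) Y = g X (B Y)"
proof -
  assume X: "X \<in> V" and Y: "Y \<in> V"
  have "X (\<eta> Y) - Y (\<eta> X) - \<eta> (lie_bracket X Y) = 0"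
    using almost_kenmotsu X Y unfolding almost_kenmotsu_manifold_def ext_deriv_1_def by blast
  then show ?thesis
    using X Y D_eta[OF X Y] D_eta[OF Y X]
    by (simp add: torsion g_sym[of Y "B X"] algebra_simps)
qed

lemma B_xi [simp]: "B \<xi> = 0"
  by (rule V_eqI) (auto simp: g_B)

definition dphi :: "'a vfield \<Rightarrow> 'a vfield \<Rightarrow> 'a vfield" where "dphi X Y = D X (\<phi> Y) - \<phi> (D X Y)"

lemma dphi_V [simp]: "X \<in> V \<Longrightarrow> Y \<in> V \<Longrightarrow> dphi X Y \<in> V"
  by (simp add: dphi_def)

lemma dphi_skew: "X \<in> V \<Longrightarrow> Y \<in> V \<Longrightarrow> Z \<in> V \<Longrightarrow> g (dphi X Y) Z p = - g (dphi X Z) Y p"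
proof -
  assume V: "X \<in> V" "Y \<in> V" "Z \<in> V"
  have "X (g (\<phi> Y) Z) p = - X (g Y (\<phi> Z)) p" using V by (simp add: V_apply_uminus[OF V(1)])
  moreover have "X (g (\<phi> Y) Z) p = g (D X (\<phi> Y)) Z p - g Y (\<phi> (D X Z)) p"
    using V D_metric[OF V(1), of "\<phi> Y" Z] by simp
  moreover have "X (g Y (\<phi> Z)) p = - g (\<phi> (D X Y)) Z p + g Y (D X (\<phi> Z)) p"
    using V D_metric[OF V(1), of Y "\<phi> Z"] by simp
  moreover have "g (dphi X Y) Z p = g (D X (\<phi> Y)) Z p - g (\<phi> (D X Y)) Z p"
    using V by (simp add: dphi_def del: g_phi)
  moreover have "g (dphi X Z) Y p = g Y (D X (\<phi> Z)) p - g Y (\<phi> (D X Z)) p"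
    using V g_sym[of "dphi X Z" Y] by (simp add: dphi_def)
  ultimately show ?thesis by linarith
qed

lemma dphi_xi: "X \<in> V \<Longrightarrow> dphi X \<xi> = - \<phi> (B X)"
  by (simp add: dphi_def)

lemma dphi_phi: "X \<in> V \<Longrightarrow> Y \<in> V \<Longrightarrow> dphi X (\<phi> Y) + \<phi> (dphi X Y) = g Y (B X) \<odot> \<xi> + \<eta> Y \<odot> B X"
  using D_eta[of X Y] V_apply[of X "\<eta> Y"] by (simp add: dphi_def scale_simps)

text \<open>Expressed through \<open>\<nabla>\<phi>\<close>, the exterior derivative of the fundamental form has no bracket terms.\<close>

lemma dphi_cyclic:
  assumes V: "X \<in> V" "Y \<in> V" "Z \<in> V"
  shows "g (dphi X Z) Y p + g (dphi Y X) Z p + g (dphi Z Y) X p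
    = 2 * (\<eta> X p * g Y (\<phi> Z) p + \<eta> Y p * g Z (\<phi> X) p + \<eta> Z p * g X (\<phi> Y) p)"
proof -
  have "ext_deriv_2 (fundamental_form \<phi> g) X Y Z = 2 * wedge_12 \<eta> (fundamental_form \<phi> g) X Y Z"
    using almost_kenmotsu V unfolding almost_kenmotsu_manifold_def by blast
  from fun_cong[OF this, of p] have e: "X (g Y (\<phi> Z)) p + Y (g Z (\<phi> X)) p + Z (g X (\<phi> Y)) p
      - g (lie_bracket X Y) (\<phi> Z) p - g (lie_bracket Y Z) (\<phi> X) p - g (lie_bracket Z X) (\<phi> Y) p
    = 2 * (\<eta> X p * g Y (\<phi> Z) p + \<eta> Y p * g Z (\<phi> X) p + \<eta> Z p * g X (\<phi> Y) p)"
    by (simp only: ext_deriv_2_def fundamental_form_def wedge_12_def two_apply plus_fun_apply minus_apply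
        times_fun_apply)
  have m: "X (g Y (\<phi> Z)) p = g (D X Y) (\<phi> Z) p + g (dphi X Z) Y p - g (D X Z) (\<phi> Y) p"
    if "X \<in> V" "Y \<in> V" "Z \<in> V" for X Y Z
    using that D_metric[OF that(1), of Y "\<phi> Z"]
    by (simp add: dphi_def g_sym[of Y "D X (\<phi> Z)"])
  have t: "g (lie_bracket X Y) (\<phi> Z) p = g (D X Y) (\<phi> Z) p - g (D Y X) (\<phi> Z) p"
    if "X \<in> V" "Y \<in> V" "Z \<in> V" for X Y Z
    using that by (simp add: torsion)
  show ?thesis
    using e m[OF V] m[OF V(2,3,1)] m[OF V(3,1,2)] t[OF V] t[OF V(2,3,1)] t[OF V(3,1,2)] by linarith
qed

text \<open>
  The mixed component of \<open>d\<Phi> = 2\<eta> \<and> \<Phi>\<close> gives \<open>\<nabla>\<^sub>\<xi>\<phi> = 2\<phi> - B\<phi> - \<phi>B\<close>. Since \<open>\<nabla>\<^sub>\<xi>\<phi>\<close> anticommutes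
  with \<open>\<phi>\<close> while the right-hand side commutes with it, both sides vanish.
\<close>

lemma dphi_along_xi: "Y \<in> V \<Longrightarrow> dphi \<xi> Y = 0"
  and B_phi: "Y \<in> V \<Longrightarrow> B (\<phi> Y) = 2 \<odot> \<phi> Y - \<phi> (B Y)"
proof -
  have C: "dphi \<xi> Z = 2 \<odot> \<phi> Z - B (\<phi> Z) - \<phi> (B Z)" if Z: "Z \<in> V" for Z
  proof (rule V_eqI)
    fix Y p assume Y: "Y \<in> V"
    have "g (dphi \<xi> Z) Y p + g (dphi Y \<xi>) Z p + g (dphi Z Y) \<xi> p = 2 * g Y (\<phi> Z) p"
      using dphi_cyclic[of \<xi> Y Z p] Y Z by simp
    moreover have "g (dphi Y \<xi>) Z p = g Y (B (\<phi> Z)) p" using Y Z by (simp add: dphi_xi)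
    moreover have "g (dphi Z Y) \<xi> p = g Y (\<phi> (B Z)) p"
      using Y Z dphi_skew[of Z Y \<xi> p] by (simp add: dphi_xi g_sym[of Y "\<phi> (B Z)"] del: g_xi_right)
    moreover have "g (B (\<phi> Z)) Y p = g Y (B (\<phi> Z)) p" "g (\<phi> (B Z)) Y p = g Y (\<phi> (B Z)) p"
      "g (\<phi> Z) Y p = g Y (\<phi> Z) p"
      using Y Z g_sym[of Y "B (\<phi> Z)"] g_sym[of Y "\<phi> (B Z)"] g_sym[of Y "\<phi> Z"] by simp_all
    ultimately show "g (dphi \<xi> Z) Y p = g (2 \<odot> \<phi> Z - B (\<phi> Z) - \<phi> (B Z)) Y p"
      using Y Z by (simp del: g_phi g_B add: algebra_simps)
  qed (use Z in auto)
  have anti: "dphi \<xi> (\<phi> Z) + \<phi> (dphi \<xi> Z) = 0" if "Z \<in> V" for Z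
    using dphi_phi[of \<xi> Z] that by simp
  have e: "B (\<phi> Z) = 2 \<odot> \<phi> Z - \<phi> (B Z)" if Z: "Z \<in> V" for Z
  proof (rule V_eqI)
    fix Y p assume Y: "Y \<in> V"
    have "g (dphi \<xi> (\<phi> Z) + \<phi> (dphi \<xi> Z)) (\<phi> Y) p = 0" unfolding anti[OF Z] using Y by simp
    then have "g (dphi \<xi> (\<phi> Z)) (\<phi> Y) p + g (\<phi> (dphi \<xi> Z)) (\<phi> Y) p = 0" using Y Z by simp
    moreover have "g (dphi \<xi> (\<phi> Z)) (\<phi> Y) p = - 2 * g Z (\<phi> Y) p + g Z (B (\<phi> Y)) p + g Z (\<phi> (B Y)) p"
      using Y Z by (simp add: C)
    moreover have "g (\<phi> (dphi \<xi> Z)) (\<phi> Y) p = - 2 * g Z (\<phi> Y) p + g Z (B (\<phi> Y)) p + g Z (\<phi> (B Y)) p"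
      using Y Z by (simp add: C)
    ultimately show "g (B (\<phi> Z)) Y p = g (2 \<odot> \<phi> Z - \<phi> (B Z)) Y p"
      using Y Z by simp
  qed (use Z in auto)
  show "B (\<phi> Y) = 2 \<odot> \<phi> Y - \<phi> (B Y)" if "Y \<in> V" by (rule e[OF that])
  show "dphi \<xi> Y = 0" if "Y \<in> V" using C[OF that] e[OF that] by (simp add: algebra_simps)
qed

section \<open>The traceless part of the shape operator\<close>

text \<open>\<open>k = -\<phi>h\<close>; the operators \<open>\<phi>\<close> and \<open>k\<close> determine everything else: \<open>B = -\<phi>\<^sup>2 + k\<close> and \<open>h = \<phi>k\<close>.\<close>

definition k :: "'a vfield \<Rightarrow> 'a vfield" where "k X = B X - X + \<eta> X \<odot> \<xi>"

lemma tensor_k: "tensor_field_11 A k"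
  by (auto simp: tensor_field_11_def k_def scale_simps algebra_simps)

lemmas k_simps [simp] = tensor_simps[OF tensor_k]

lemma k_xi [simp]: "k \<xi> = 0" and eta_k [simp]: "X \<in> V \<Longrightarrow> \<eta> (k X) = 0"
  by (simp_all add: k_def)

lemma g_k [simp]: "X \<in> V \<Longrightarrow> Y \<in> V \<Longrightarrow> g (k X) Y = g X (k Y)"
  by (simp add: k_def algebra_simps)

lemma k_phi [simp]: "X \<in> V \<Longrightarrow> k (\<phi> X) = - \<phi> (k X)"
  by (simp add: k_def B_phi) (auto simp: fun_eq_iff scale_def)

lemma h_eq: "X \<in> V \<Longrightarrow> h_tensor \<phi> \<xi> X = \<phi> (k X)"
proof -
  assume X: "X \<in> V"
  have "D \<xi> (\<phi> X) = \<phi> (D \<xi> X)" using dphi_along_xi[OF X] by (simp add: dphi_def)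
  then have "lie_derivative_11 \<xi> \<phi> X = 2 \<odot> \<phi> (k X)"
    using X by (simp add: lie_derivative_11_def torsion B_phi k_def)
      (auto simp: fun_eq_iff scale_def)
  then show ?thesis by (auto simp: h_tensor_def fun_eq_iff scale_def)
qed

text \<open>
  The sections of \<open>ker \<eta>\<close>. They are closed under the bracket because \<open>d\<eta> = 0\<close>.
\<close>

definition H :: "'a vfield set" where "H = {X \<in> V. \<eta> X = 0}"

lemma H_I: "X \<in> V \<Longrightarrow> \<eta> X = 0 \<Longrightarrow> X \<in> H"
  by (simp add: H_def)

lemma H_V: "X \<in> H \<Longrightarrow> X \<in> V" and H_eta [simp]: "X \<in> H \<Longrightarrow> \<eta> X = 0"
  by (auto simp: H_def)

lemma H_closed [simp]: "X \<in> V \<Longrightarrow> \<phi> X \<in> H" "X \<in> V \<Longrightarrow> k X \<in> H" "X \<in> V \<Longrightarrow> B X \<in> H"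
  "X \<in> H \<Longrightarrow> Y \<in> H \<Longrightarrow> X + Y \<in> H" "X \<in> H \<Longrightarrow> Y \<in> H \<Longrightarrow> X - Y \<in> H" "X \<in> H \<Longrightarrow> - X \<in> H"
  "X \<in> H \<Longrightarrow> u \<in> F \<Longrightarrow> u \<odot> X \<in> H" "0 \<in> H"
  "X \<in> V \<Longrightarrow> X - \<eta> X \<odot> \<xi> \<in> H"
  by (rule H_I; simp add: H_V)+

lemma B_H: "X \<in> H \<Longrightarrow> B X = X + k X" by (simp add: k_def)

lemma H_eqI:
  assumes "X \<in> H" "Y \<in> H" "\<And>Z p. Z \<in> H \<Longrightarrow> g X Z p = g Y Z p"
  shows "X = Y"
proof (rule V_eqI)
  fix Z p assume Z: "Z \<in> V"
  have "g X (Z - \<eta> Z \<odot> \<xi>) p = g Y (Z - \<eta> Z \<odot> \<xi>) p" using assms(3) Z by (simp del: g_right)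
  then show "g X Z p = g Y Z p" using assms(1,2)[THEN H_V] assms(1,2) Z by simp
qed (use assms H_V in auto)

lemma eta_D: "X \<in> V \<Longrightarrow> Y \<in> H \<Longrightarrow> \<eta> (D X Y) = - g Y (B X)"
  using D_eta[of X Y] V_apply_0[of X] by (simp add: H_V eq_neg_iff_add_eq_0)

lemma bracket_H: "X \<in> H \<Longrightarrow> Y \<in> H \<Longrightarrow> lie_bracket X Y \<in> H"
  using g_sym[of Y "B X"] by (intro H_I) (simp_all add: H_V torsion eta_D)

definition dk :: "'a vfield \<Rightarrow> 'a vfield \<Rightarrow> 'a vfield" where "dk X Y = D X (k Y) - k (D X Y)"

lemma dk_V [simp]: "X \<in> V \<Longrightarrow> Y \<in> V \<Longrightarrow> dk X Y \<in> V"
  by (simp add: dk_def)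

lemma dk_sym: "X \<in> V \<Longrightarrow> Y \<in> V \<Longrightarrow> Z \<in> V \<Longrightarrow> g (dk X Y) Z p = g (dk X Z) Y p"
proof -
  assume V: "X \<in> V" "Y \<in> V" "Z \<in> V"
  have "X (g (k Y) Z) p = X (g Y (k Z)) p" using V by simp
  moreover have "X (g (k Y) Z) p = g (D X (k Y)) Z p + g Y (k (D X Z)) p"
    using V D_metric[OF V(1), of "k Y" Z] by simp
  moreover have "X (g Y (k Z)) p = g (k (D X Y)) Z p + g Y (D X (k Z)) p"
    using V D_metric[OF V(1), of Y "k Z"] by simp
  moreover have "g (dk X Y) Z p = g (D X (k Y)) Z p - g (k (D X Y)) Z p"
    using V by (simp add: dk_def del: g_k)
  moreover have "g (dk X Z) Y p = g Y (D X (k Z)) p - g Y (k (D X Z)) p"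
    using V g_sym[of "dk X Z" Y] by (simp add: dk_def)
  ultimately show ?thesis by linarith
qed

lemma dk_phi: "X \<in> V \<Longrightarrow> Y \<in> V \<Longrightarrow> dk X (\<phi> Y) + \<phi> (dk X Y) = - dphi X (k Y) - k (dphi X Y)"
  by (simp add: dk_def dphi_def)

lemma tensor_dphi: "Y \<in> V \<Longrightarrow> tensor_field_11 A (\<lambda>X. dphi X Y)"
  by (auto simp: tensor_field_11_def dphi_def scale_simps algebra_simps)

lemma curvature_xi_xi: "X \<in> H \<Longrightarrow> curvature D X \<xi> \<xi> = - (dk \<xi> X + X + 2 \<odot> k X + k (k X))"
proof -
  assume X: "X \<in> H"
  have "D \<xi> X \<in> H" using X by (intro H_I) (simp_all add: eta_D H_V)
  then show ?thesis
    using X H_V[OF X] by (simp add: curvature_def torsion B_H dk_def) (auto simp: fun_eq_iff scale_def)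
qed

lemma curvature_xi: "X \<in> H \<Longrightarrow> Y \<in> H \<Longrightarrow> curvature D X Y \<xi> = dk X Y - dk Y X"
proof -
  assume X: "X \<in> H" "Y \<in> H"
  show ?thesis
    using X[THEN H_V] B_H[OF bracket_H[OF X]]
    by (simp add: curvature_def torsion B_H[OF X(1)] B_H[OF X(2)] dk_def del: B_simps)
qed

end

section \<open>The shape operator of a space form\<close>

locale hypothetical_space_form = almost_kenmotsu A \<phi> \<xi> \<eta> g D
  for A :: "('a::{t2_space, second_countable_topology}, 'e::euclidean_space) atlas"
    and \<phi> :: "'a vfield \<Rightarrow> 'a vfield" and \<xi> :: "'a vfield" and \<eta> :: "'a vfield \<Rightarrow> 'a \<Rightarrow> real"
    and g :: "'a vfield \<Rightarrow> 'a vfield \<Rightarrow> 'a \<Rightarrow> real" and D :: "'a vfield \<Rightarrow> 'a vfield \<Rightarrow> 'a vfield" +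
  fixes f1 f2 f3 f4 f5 f6 f7 f8 :: "'a \<Rightarrow> real"
  assumes f_F: "{f1, f2, f3, f4, f5, f6, f7, f8} \<subseteq> smooth_functions A"
    and curvature_eq: "X \<in> vector_fields A \<Longrightarrow> Y \<in> vector_fields A \<Longrightarrow> Z \<in> vector_fields A \<Longrightarrow>
      curvature D X Y Z =
          f1 \<odot> R1 g X Y Z + f2 \<odot> R2 \<phi> g X Y Z + f3 \<odot> R3 \<xi> \<eta> g X Y Z + f4 \<odot> R4 \<phi> \<xi> g X Y Z
          + f5 \<odot> R5 \<phi> \<xi> g X Y Z + f6 \<odot> R6 \<phi> \<xi> \<eta> g X Y Z + f7 \<odot> R7 \<phi> \<xi> g X Y Z
          + f8 \<odot> R8 \<phi> \<xi> \<eta> g X Y Z"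
    and kappa: "f1 p - f3 p < -1"
    and dim: "DIM('e) \<ge> 5"
begin

lemma f_F' [simp]: "f1 \<in> F" "f2 \<in> F" "f3 \<in> F" "f4 \<in> F" "f5 \<in> F" "f6 \<in> F" "f7 \<in> F" "f8 \<in> F"
  using f_F by auto

lemmas R_defs = R1_def R2_def R3_def R4_def R5_def R6_def R7_def R8_def

text \<open>This is \<open>-1-\<kappa>\<close>; it turns out to be the square of the eigenvalues of \<open>k\<close> on \<open>ker \<eta>\<close>.\<close>

definition \<sigma> :: "'a \<Rightarrow> real" where "\<sigma> = f3 - f1 - 1"

lemma sigma_F [simp]: "\<sigma> \<in> F" and sigma_pos: "\<sigma> p > 0"
  using kappa[of p] by (simp_all add: \<sigma>_def)

text \<open>
  In \<open>R(X,\<xi>)\<xi>\<close> only the terms \<open>X\<close> and \<open>k\<^sup>2X\<close> commute with \<open>\<phi>\<close>; the terms in \<open>\<nabla>\<^sub>\<xi>k\<close>, \<open>k\<close> and \<open>\<phi>k\<close>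
  anticommute with it.
\<close>

lemma k_k:
  assumes X: "X \<in> H"
  shows "k (k X) = \<sigma> \<odot> X"
proof -
  let ?a = "f1 - f3" and ?b = "f4 - f6" and ?c = "f7 - f8"
  have e: "- (dk \<xi> X + X + 2 \<odot> k X + k (k X)) = ?a \<odot> X + ?b \<odot> \<phi> (k X) - ?c \<odot> k X" if X: "X \<in> H" for X
  proof -
    have "curvature D X \<xi> \<xi> = ?a \<odot> X + ?b \<odot> \<phi> (k X) - ?c \<odot> k X"
      using X H_V[OF X] by (simp add: curvature_eq R_defs h_eq) (auto simp: fun_eq_iff scale_def algebra_simps)
    then show ?thesis using curvature_xi_xi[OF X] by simp
  qed
  have v: "X \<in> V" using X by (rule H_V)
  have dk: "dk \<xi> (\<phi> X) = - \<phi> (dk \<xi> X)"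
    using dk_phi[OF xi_V v] v by (simp add: dphi_along_xi eq_neg_iff_add_eq_0)
  show ?thesis
  proof (rule H_eqI)
    fix Z p assume Z: "Z \<in> H"
    note z = H_V[OF Z]
    have "g (- (dk \<xi> (\<phi> X) + \<phi> X + 2 \<odot> k (\<phi> X) + k (k (\<phi> X)))) (\<phi> Z) p
      = g (?a \<odot> \<phi> X + ?b \<odot> \<phi> (k (\<phi> X)) - ?c \<odot> k (\<phi> X)) (\<phi> Z) p"
      using e[of "\<phi> X"] v by simp
    then have 1: "- (- g (dk \<xi> X) Z p + g X Z p - 2 * g X (k Z) p + g X (k (k Z)) p)
        = ?a p * g X Z p - ?b p * g (\<phi> (k X)) Z p + ?c p * g X (k Z) p"
      using v z X Z by (simp add: dk algebra_simps)
    have "g (- (dk \<xi> X + X + 2 \<odot> k X + k (k X))) Z p = g (?a \<odot> X + ?b \<odot> \<phi> (k X) - ?c \<odot> k X) Z p"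
      using e[OF X] by simp
    then have 2: "- (g (dk \<xi> X) Z p + g X Z p + 2 * g X (k Z) p + g X (k (k Z)) p)
        = ?a p * g X Z p + ?b p * g (\<phi> (k X)) Z p - ?c p * g X (k Z) p"
      using v z by (simp del: g_phi add: algebra_simps)
    have "g X (k (k Z)) p = - (?a p + 1) * g X Z p"
      using 1 2 by (simp only: left_diff_distrib distrib_right minus_mult_left[symmetric])
    then show "g (k (k X)) Z p = g (\<sigma> \<odot> X) Z p"
      using v z by (simp add: \<sigma>_def algebra_simps)
  qed (use X v in auto)
qed

text \<open>The Codazzi equation: all \<open>R\<^sub>i(X,Y)\<xi>\<close> vanish for \<open>X, Y\<close> in \<open>ker \<eta>\<close>.\<close>

lemma dk_commute:
  assumes "X \<in> H" "Y \<in> H"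
  shows "dk X Y = dk Y X"
proof -
  have "curvature D X Y \<xi> = 0"
    using assms assms[THEN H_V] by (simp add: curvature_eq R_defs h_eq)
  then show ?thesis using curvature_xi[OF assms] by simp
qed

section \<open>The complex structure is parallel along the leaves\<close>

lemma N_phi_right:
  assumes "X \<in> H" "Y \<in> H" "Z \<in> H"
  shows "g (dphi X (\<phi> Y)) Z p = g (dphi X Y) (\<phi> Z) p"
proof -
  note v = assms[THEN H_V]
  have "g (dphi X (\<phi> Y) + \<phi> (dphi X Y)) Z p = g (g Y (B X) \<odot> \<xi> + \<eta> Y \<odot> B X) Z p"
    using dphi_phi[OF v(1,2)] by simp
  then show ?thesis using v assms by simp
qed

lemma N_cyclic:
  assumes "X \<in> H" "Y \<in> H" "Z \<in> H"
  shows "g (dphi X Y) Z p + g (dphi Y Z) X p + g (dphi Z X) Y p = 0"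
  using dphi_cyclic[of X Z Y p] assms assms[THEN H_V] by (simp add: algebra_simps)

text \<open>
  The familiar identity of almost Kaehler manifolds: it is a linear consequence of the cyclic identity for
  \<open>(\<phi>X,Y,Z)\<close>, \<open>(X,\<phi>Y,Z)\<close>, \<open>(X,Y,\<phi>Z)\<close> and \<open>(\<phi>X,\<phi>Y,\<phi>Z)\<close>.
\<close>

lemma N_phi_left:
  assumes H: "X \<in> H" "Y \<in> H" "Z \<in> H"
  shows "g (dphi (\<phi> X) Y) Z p = g (dphi X (\<phi> Y)) Z p"
proof -
  note v = H[THEN H_V]
  have [simp]: "\<phi> X \<in> H" "\<phi> Y \<in> H" "\<phi> Z \<in> H" using v by simp_all
  have m: "g (dphi (\<phi> X) (\<phi> Y)) (\<phi> Z) p = - g (dphi (\<phi> X) Y) Z p" if "X \<in> H" "Y \<in> H" "Z \<in> H" for X Y Z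
    using N_phi_right[of "\<phi> X" Y "\<phi> Z" p] that that[THEN H_V] by simp
  show ?thesis
    using N_cyclic[of "\<phi> X" Y Z p] N_cyclic[of X "\<phi> Y" Z p] N_cyclic[of X Y "\<phi> Z" p]
      N_cyclic[of "\<phi> X" "\<phi> Y" "\<phi> Z" p] m[of X Y Z] m[of Y Z X] m[of Z X Y]
      N_phi_right[of X Y Z p] N_phi_right[of Y Z X p] N_phi_right[of Z X Y p] H by simp
qed

text \<open>
  Differentiating \<open>k\<phi> + \<phi>k = 0\<close> expresses \<open>N(X,kY,Z) + N(X,Y,kZ)\<close>, where \<open>N(X,Y,Z) = g((\<nabla>\<^sub>X\<phi>)Y,Z)\<close>,
  by the totally symmetric form \<open>g((\<nabla>\<^sub>Xk)Y,Z)\<close>. Eliminating the latter, with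
  \<open>M(X,Y,Z) = N(X,\<phi>Y,Z)\<close>, leaves \<open>M(kX,Y,Z) = M(kY,Z,X) + M(kZ,X,Y)\<close>. Adding the same
  identity for \<open>(Y,Z,X)\<close> gives \<open>M(kZ,X,Y) = 0\<close>.
\<close>

lemma N_k_zero:
  assumes H: "X \<in> H" "Y \<in> H" "Z \<in> H"
  shows "g (dphi (k Z) (\<phi> X)) Y p = 0"
proof -
  let ?N = "\<lambda>X Y Z. g (dphi X Y) Z p"
  let ?S = "\<lambda>X Y Z. g (dk X Y) Z p"
  let ?M = "\<lambda>X Y Z. g (dphi X (\<phi> Y)) Z p"
  have kH: "k X \<in> H" "\<phi> X \<in> H" if "X \<in> H" for X using H_V[OF that] by simp_all
  have neg: "dphi X (- Y) = - dphi X Y" "dk X (- Y) = - dk X Y" if "X \<in> V" "Y \<in> V" for X Y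
    using that by (simp_all add: dphi_def dk_def)
  have M_skew: "?M X Y Z = - ?M X Z Y" if "X \<in> H" "Y \<in> H" "Z \<in> H" for X Y Z
    using N_phi_right[OF that] dphi_skew[of X Y "\<phi> Z" p] that[THEN H_V] by simp
  have M_cyc: "?M X Y Z + ?M Y Z X + ?M Z X Y = 0" if "X \<in> H" "Y \<in> H" "Z \<in> H" for X Y Z
    using N_cyclic[OF that(1,2) kH(2)[OF that(3)], of p] N_phi_right[OF that, of p] N_phi_left[OF that(3,1,2), of p]
    by simp
  have M_phi: "?M (\<phi> X) (\<phi> Y) Z = - ?M X Y Z" if "X \<in> H" "Y \<in> H" "Z \<in> H" for X Y Z
    using N_phi_left[OF that, of p] that that[THEN H_V] by (simp add: neg)
  have S_sym: "?S X Y Z = ?S Y X Z" "?S X Y Z = ?S X Z Y" if "X \<in> H" "Y \<in> H" "Z \<in> H" for X Y Z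
    using dk_commute[OF that(1,2)] dk_sym that[THEN H_V] by auto
  have F: "?S X (\<phi> Y) (\<phi> Z) + ?S X Y Z = ?M X Y (k Z) + ?M X Z (k Y)" if H: "X \<in> H" "Y \<in> H" "Z \<in> H" for X Y Z
  proof -
    note v = H[THEN H_V]
    have "g (dk X (\<phi> (\<phi> Y)) + \<phi> (dk X (\<phi> Y))) Z p = g (- dphi X (k (\<phi> Y)) - k (dphi X (\<phi> Y))) Z p"
      using dk_phi[of X "\<phi> Y"] v by simp
    then have "?S X Y Z + ?S X (\<phi> Y) (\<phi> Z) = ?M X Y (k Z) - ?M X (k Y) Z"
      using v H by (simp add: neg)
    then show ?thesis using M_skew[of X "k Y" Z] H kH by simp
  qed
  have star: "?M (k X) Y Z = ?M (k Y) Z X + ?M (k Z) X Y" if H: "X \<in> H" "Y \<in> H" "Z \<in> H" for X Y Z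
  proof -
    note v = H[THEN H_V] and c = H kH(1)[OF H(1)] kH(1)[OF H(2)] kH(1)[OF H(3)]
      kH(2)[OF H(1)] kH(2)[OF H(2)] kH(2)[OF H(3)]
    have "?M (\<phi> X) Z (k (\<phi> Y)) = ?M X Z (k Y)"
    proof -
      have "?M (\<phi> X) Z (k (\<phi> Y)) = - ?M (\<phi> X) Z (\<phi> (k Y))" using v by simp
      also have "\<dots> = ?M (\<phi> X) (\<phi> (k Y)) Z" using M_skew[of "\<phi> X" Z "\<phi> (k Y)"] c kH by simp
      also have "\<dots> = - ?M X (k Y) Z" using M_phi[of X "k Y" Z] c by simp
      also have "\<dots> = ?M X Z (k Y)" using M_skew[of X "k Y" Z] c by simp
      finally show ?thesis .
    qed
    moreover have "?S (\<phi> X) (\<phi> (\<phi> Y)) (\<phi> Z) = - ?S (\<phi> X) Y (\<phi> Z)" using v H by (simp add: neg)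
    ultimately have "?S (\<phi> X) (\<phi> Y) Z - ?S (\<phi> X) Y (\<phi> Z) = ?M X Z (k Y) - ?M X Y (k Z)"
      using F[of "\<phi> X" "\<phi> Y" Z] M_phi[of X Y "k Z"] c by simp
    moreover have "?S (\<phi> X) (\<phi> Y) Z = ?S Z (\<phi> X) (\<phi> Y)" "?S (\<phi> X) Y (\<phi> Z) = ?S Y (\<phi> Z) (\<phi> X)"
      "?S Z X Y = ?S Y Z X"
      using S_sym(2)[of "\<phi> X" "\<phi> Y" Z] S_sym(1)[of "\<phi> X" Z "\<phi> Y"]
        S_sym(1)[of "\<phi> X" Y "\<phi> Z"] S_sym(2)[of Y "\<phi> X" "\<phi> Z"]
        S_sym(2)[of Z X Y] S_sym(1)[of Z Y X] S_sym(2)[of Y Z X] c by linarith+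
    ultimately have "?M X Z (k Y) - ?M X Y (k Z)
        = ?M Z X (k Y) + ?M Z Y (k X) - (?M Y Z (k X) + ?M Y X (k Z))"
      using F[OF H(3,1,2)] F[OF H(2,3,1)] by linarith
    then show ?thesis
      using M_cyc[of X Z "k Y"] M_skew[of X Z "k Y"] M_skew[of Z "k Y" X] M_skew[of "k Y" X Z]
        M_cyc[of X Y "k Z"] M_skew[of Y "k Z" X] M_skew[of "k Z" X Y]
        M_cyc[of Z Y "k X"] M_skew[of Y "k X" Z] M_skew[of "k X" Z Y] c
      by simp
  qed
  show ?thesis using star[OF H] star[OF H(2,3,1)] by linarith
qed

lemma N_zero:
  assumes H: "X \<in> H" "Y \<in> H" "Z \<in> H"
  shows "g (dphi X Y) Z p = 0"
proof -
  note v = H[THEN H_V]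
  have "g (dphi (k (k X)) (\<phi> (\<phi> Y))) Z p = 0"
    by (rule N_k_zero) (use v H in auto)
  moreover have "\<phi> (\<phi> Y) = - Y" using v H by simp
  moreover have "dphi W (- Y) = - dphi W Y" if "W \<in> V" for W
    using that v by (simp add: dphi_def)
  ultimately have "\<sigma> p * g (dphi X Y) Z p = 0"
    using v k_k[OF H(1)] tensor_simps(3)[OF tensor_dphi[OF v(2)]] by simp
  then show ?thesis using sigma_pos[of p] by simp
qed

section \<open>The shape operator is parallel along the leaves\<close>

lemma orthogonal_horizontal_exists:
  assumes S: "finite S" "S \<subseteq> V" "card S \<le> 3"
  obtains Y where "Y \<in> H" "g Y Y p \<noteq> 0" "\<And>X. X \<in> S \<Longrightarrow> g X Y p = 0"
proof -
  have "card (insert \<xi> S) < DIM('e)" using card_insert_le_m1[of 4 S \<xi>] S dim by simp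
  then obtain Y where Y: "Y \<in> V" "g Y Y p \<noteq> 0" "\<And>X. X \<in> insert \<xi> S \<Longrightarrow> g X Y p = 0"
    using orthogonal_vector_field_exists[OF atlas metric, of "insert \<xi> S" p] S by auto
  have 0: "\<eta> Y p = 0" using Y(1) Y(3)[of \<xi>] by simp
  show ?thesis
  proof (rule that[of "Y - \<eta> Y \<odot> \<xi>"])
    show "g X (Y - \<eta> Y \<odot> \<xi>) p = 0" if "X \<in> S" for X
      using that Y 0 S(2) by auto
  qed (use Y 0 in auto)
qed

text \<open>
  With \<open>S(X,Y,Z) = g((\<nabla>\<^sub>Xk)Y,Z)\<close>, the derivative of \<open>k\<^sup>2 = \<sigma>\<close> is a condition on \<open>S(X,Y,kZ)\<close>,
  and because \<open>\<phi>\<close> may be moved between the arguments of the symmetric form \<open>S\<close>, applying it also to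
  \<open>\<phi>X, \<phi>Y\<close> determines \<open>S(X,Y,kZ)\<close> by \<open>d\<sigma>\<close>.
\<close>

lemma S_d_sigma:
  assumes H: "X \<in> H" "Y \<in> H" "Z \<in> H"
  shows "2 * g (dk X Y) (k Z) p = X \<sigma> p * g Y Z p - (\<phi> X) \<sigma> p * g (\<phi> Y) Z p"
proof -
  let ?S = "\<lambda>X Y Z. g (dk X Y) Z p"
  have kH: "k X \<in> H" "\<phi> X \<in> H" if "X \<in> H" for X using H_V[OF that] by simp_all
  have S_sym: "?S X Y Z = ?S Y X Z" "?S X Y Z = ?S X Z Y" if "X \<in> H" "Y \<in> H" "Z \<in> H" for X Y Z
    using dk_commute[OF that(1,2)] dk_sym that[THEN H_V] by auto
  have S_phi: "?S X (\<phi> Y) Z = ?S X Y (\<phi> Z)" if H: "X \<in> H" "Y \<in> H" "Z \<in> H" for X Y Z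
  proof -
    note v = H[THEN H_V]
    have "g (dk X (\<phi> Y) + \<phi> (dk X Y)) Z p = g (- dphi X (k Y) - k (dphi X Y)) Z p"
      using dk_phi[of X Y] v by simp
    then show ?thesis using v H N_zero[of X "k Y" Z] N_zero[of X Y "k Z"] by simp
  qed
  have sq: "?S X (k Y) Z + ?S X Y (k Z) = X \<sigma> p * g Y Z p" if H: "X \<in> H" "Y \<in> H" "Z \<in> H" for X Y Z
  proof -
    note v = H[THEN H_V] and [simp] = V_apply[OF H_V[OF H(1)]]
    have kk: "g W (k (k Z)) p = \<sigma> p * g W Z p" if "W \<in> V" for W
      using that k_k[OF H(3)] v by simp
    have "dk X (k Y) + k (dk X Y) = D X (k (k Y)) - k (k (D X Y))" using v by (simp add: dk_def)
    also have "\<dots> = X \<sigma> \<odot> Y + \<sigma> \<odot> D X Y - k (k (D X Y))" using v k_k[OF H(2)] by simp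
    finally have "g (dk X (k Y) + k (dk X Y)) Z p = g (X \<sigma> \<odot> Y + \<sigma> \<odot> D X Y - k (k (D X Y))) Z p" by simp
    then show ?thesis using v by (simp add: kk)
  qed
  note v = H[THEN H_V] and c = H kH(1)[OF H(1)] kH(1)[OF H(2)] kH(1)[OF H(3)]
      kH(2)[OF H(1)] kH(2)[OF H(2)] kH(2)[OF H(3)]
  have "?S (\<phi> X) (k (\<phi> Y)) Z = - ?S (\<phi> X) (\<phi> (k Y)) Z"
    using v by (simp add: dk_def)
  also have "\<dots> = - ?S (k Y) (\<phi> (\<phi> X)) Z"
    using S_phi[of "\<phi> X" "k Y" Z] S_sym(1)[of "\<phi> X" "k Y" "\<phi> Z"] S_phi[of "k Y" "\<phi> X" Z] c by linarith
  also have "\<dots> = ?S X (k Y) Z"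
  proof -
    have "?S (k Y) (\<phi> (\<phi> X)) Z = - ?S (k Y) X Z" using v c by (simp add: dk_def)
    then show ?thesis using S_sym(1)[of X "k Y" Z] c by simp
  qed
  finally have 1: "?S (\<phi> X) (k (\<phi> Y)) Z = ?S X (k Y) Z" .
  have "?S (\<phi> X) (\<phi> Y) (k Z) = ?S Y (\<phi> (\<phi> X)) (k Z)"
    using S_phi[of "\<phi> X" Y "k Z"] S_sym(1)[of "\<phi> X" Y "\<phi> (k Z)"] S_phi[of Y "\<phi> X" "k Z"] c
      kH(2)[OF c(6)] by linarith
  also have "\<dots> = - ?S X Y (k Z)"
  proof -
    have "?S Y (\<phi> (\<phi> X)) (k Z) = - ?S Y X (k Z)" using v c by (simp add: dk_def)
    then show ?thesis using S_sym(1)[of X Y "k Z"] c by simp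
  qed
  finally have 2: "?S (\<phi> X) (\<phi> Y) (k Z) = - ?S X Y (k Z)" .
  show ?thesis
    using sq[of X Y Z] sq[of "\<phi> X" "\<phi> Y" Z] 1 2 c by linarith
qed

text \<open>
  The left-hand side of the previous identity is symmetric in \<open>X\<close> and \<open>Y\<close>; for \<open>Y = Z\<close> orthogonal to \<open>X\<close> and
  \<open>\<phi>X\<close> this leaves \<open>X\<sigma> g(Y,Y) = 0\<close>. Such a \<open>Y\<close> exists only because the dimension is at least 5.
\<close>

lemma d_sigma_zero:
  assumes X: "X \<in> H"
  shows "X \<sigma> p = 0"
proof -
  note v = H_V[OF X]
  have "card {X, \<phi> X} \<le> 3" by (simp add: card_insert_if)
  then obtain Y where Y: "Y \<in> H" "g Y Y p \<noteq> 0" "\<And>W. W \<in> {X, \<phi> X} \<Longrightarrow> g W Y p = 0"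
    using orthogonal_horizontal_exists[of "{X, \<phi> X}" p thesis] v by simp
  note w = H_V[OF Y(1)]
  have "g (\<phi> Y) Y p = 0" using fun_cong[OF g_sym[of Y "\<phi> Y"], of p] w by simp
  moreover have "g (dk X Y) (k Y) p = g (dk Y X) (k Y) p" using dk_commute[OF X Y(1)] by simp
  ultimately show ?thesis
    using S_d_sigma[OF X Y(1,1), of p] S_d_sigma[OF Y(1) X Y(1), of p] Y(2) Y(3)[of X] Y(3)[of "\<phi> X"]
    by simp
qed

lemma S_zero:
  assumes H: "X \<in> H" "Y \<in> H" "Z \<in> H"
  shows "g (dk X Y) Z p = 0"
proof -
  note v = H[THEN H_V]
  have "g (dk X Y) (k (k Z)) p = 0"
    using S_d_sigma[of X Y "k Z" p] d_sigma_zero[of X p] d_sigma_zero[of "\<phi> X" p] v H by simp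
  then show ?thesis using k_k[OF H(3)] v sigma_pos[of p] by simp
qed

section \<open>The curvature of the leaves\<close>

text \<open>The Levi-Civita connection of the leaves is the horizontal part of \<open>\<nabla>\<close>.\<close>

definition leafD :: "'a vfield \<Rightarrow> 'a vfield \<Rightarrow> 'a vfield"
  where "leafD X Y = D X Y - \<eta> (D X Y) \<odot> \<xi>"

definition leaf_curvature :: "'a vfield \<Rightarrow> 'a vfield \<Rightarrow> 'a vfield \<Rightarrow> 'a vfield"
  where "leaf_curvature X Y Z = leafD X (leafD Y Z) - leafD Y (leafD X Z) - leafD (lie_bracket X Y) Z"

lemma leafD_H: "X \<in> V \<Longrightarrow> Y \<in> V \<Longrightarrow> leafD X Y \<in> H"
  by (simp add: leafD_def)

lemma leafD_k:
  assumes "X \<in> H" "Y \<in> H"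
  shows "leafD X (k Y) = k (leafD X Y)"
proof (rule H_eqI)
  fix Z p assume Z: "Z \<in> H"
  show "g (leafD X (k Y)) Z p = g (k (leafD X Y)) Z p"
    using S_zero[OF assms Z, of p] assms[THEN H_V] Z H_V[OF Z] by (simp add: dk_def leafD_def)
qed (use assms[THEN H_V] leafD_H H_V in auto)

lemma leafD_phi:
  assumes "X \<in> H" "Y \<in> H"
  shows "leafD X (\<phi> Y) = \<phi> (leafD X Y)"
proof (rule H_eqI)
  fix Z p assume Z: "Z \<in> H"
  show "g (leafD X (\<phi> Y)) Z p = g (\<phi> (leafD X Y)) Z p"
    using N_zero[OF assms Z, of p] assms[THEN H_V] Z H_V[OF Z] by (simp add: dphi_def leafD_def)
qed (use assms[THEN H_V] leafD_H H_V in auto)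

lemma leaf_curvature_commute:
  assumes "X \<in> H" "Y \<in> H" "Z \<in> H"
  shows "leaf_curvature X Y (k Z) = k (leaf_curvature X Y Z)"
    "leaf_curvature X Y (\<phi> Z) = \<phi> (leaf_curvature X Y Z)"
proof -
  note v = assms[THEN H_V] and b = bracket_H[OF assms(1,2)]
  have [simp]: "leafD U W \<in> V" if "U \<in> V" "W \<in> V" for U W using leafD_H[OF that] by (rule H_V)
  show "leaf_curvature X Y (k Z) = k (leaf_curvature X Y Z)"
    "leaf_curvature X Y (\<phi> Z) = \<phi> (leaf_curvature X Y Z)"
    using v assms b leafD_H by (simp_all add: leaf_curvature_def leafD_k leafD_phi)
qed

text \<open>
  This is the Gauss equation for the leaves: the vertical part \<open>-g(BY,Z)\<xi>\<close> of \<open>\<nabla>\<^sub>YZ\<close> contributes \<open>-g(BY,Z)BX\<close>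
  to \<open>\<nabla>\<^sub>X\<nabla>\<^sub>YZ\<close>.
\<close>

lemma leaf_curvature_gauss:
  assumes "X \<in> H" "Y \<in> H" "Z \<in> H" "W \<in> H"
  shows "g (leaf_curvature X Y Z) W p = g (curvature D X Y Z) W p
    + g Y (B Z) p * g X (B W) p - g X (B Z) p * g Y (B W) p"
proof -
  note v = assms[THEN H_V]
  have 1: "g (leafD X (leafD Y Z)) W p = g (D X (D Y Z)) W p + g Y (B Z) p * g X (B W) p"
    if "X \<in> H" "Y \<in> H" for X Y
  proof -
    note x = H_V[OF that(1)] H_V[OF that(2)] and [simp] = V_apply[OF H_V[OF that(1)]]
    show ?thesis
      using x v assms eta_D[OF x(2) assms(3)] g_sym[of Z "B Y"] by (simp add: leafD_def)
  qed
  have 2: "g (leafD (lie_bracket X Y) Z) W p = g (D (lie_bracket X Y) Z) W p"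
    using v assms by (simp add: leafD_def)
  show ?thesis
    using v leafD_H[THEN H_V] by (simp add: leaf_curvature_def curvature_def 1[OF assms(1,2)] 1[OF assms(2,1)] 2)
qed

text \<open>
  Every argument enters this formula only through its value at \<open>p\<close>, so it may be evaluated on fields that are
  eigenvectors of \<open>k\<close> at \<open>p\<close> only.
\<close>

lemma leaf_curvature_formula:
  assumes "X \<in> H" "Y \<in> H" "Z \<in> H" "W \<in> H"
  shows "g (leaf_curvature X Y Z) W p =
    (f1 p + 1) * (g Y Z p * g X W p - g X Z p * g Y W p)
    + f2 p * (g X (\<phi> Z) p * g (\<phi> Y) W p - g Y (\<phi> Z) p * g (\<phi> X) W p + 2 * g X (\<phi> Y) p * g (\<phi> Z) W p)
    + f4 p * (g Y Z p * g (\<phi> (k X)) W p - g X Z p * g (\<phi> (k Y)) W p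
            + g (\<phi> (k Y)) Z p * g X W p - g (\<phi> (k X)) Z p * g Y W p)
    + f5 p * (g (\<phi> (k Y)) Z p * g (\<phi> (k X)) W p - g (\<phi> (k X)) Z p * g (\<phi> (k Y)) W p
            + g (k X) Z p * g (k Y) W p - g (k Y) Z p * g (k X) W p)
    + (1 - f7 p) * (g Y Z p * g (k X) W p - g X Z p * g (k Y) W p + g (k Y) Z p * g X W p - g (k X) Z p * g Y W p)
    + (g (k Y) Z p * g (k X) W p - g (k X) Z p * g (k Y) W p)"
proof -
  note v = assms[THEN H_V]
  have "g (curvature D X Y Z) W p =
    f1 p * (g Y Z p * g X W p - g X Z p * g Y W p)
    + f2 p * (g X (\<phi> Z) p * g (\<phi> Y) W p - g Y (\<phi> Z) p * g (\<phi> X) W p + 2 * g X (\<phi> Y) p * g (\<phi> Z) W p)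
    + f4 p * (g Y Z p * g (\<phi> (k X)) W p - g X Z p * g (\<phi> (k Y)) W p
            + g (\<phi> (k Y)) Z p * g X W p - g (\<phi> (k X)) Z p * g Y W p)
    + f5 p * (g (\<phi> (k Y)) Z p * g (\<phi> (k X)) W p - g (\<phi> (k X)) Z p * g (\<phi> (k Y)) W p
            + g (k X) Z p * g (k Y) W p - g (k Y) Z p * g (k X) W p)
    - f7 p * (g Y Z p * g (k X) W p - g X Z p * g (k Y) W p + g (k Y) Z p * g X W p - g (k X) Z p * g Y W p)"
    using v assms by (simp add: curvature_eq R_defs h_eq del: g_phi g_k)
      (simp add: algebra_simps)
  then show ?thesis
    unfolding leaf_curvature_gauss[OF assms] B_H[OF assms(3)] B_H[OF assms(4)]
    using v by (simp add: algebra_simps)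
qed

lemma leaf_curvature_V: "X \<in> H \<Longrightarrow> Y \<in> H \<Longrightarrow> Z \<in> H \<Longrightarrow> leaf_curvature X Y Z \<in> V"
  using leafD_H[THEN H_V] H_V by (simp add: leaf_curvature_def)

text \<open>
  Since \<open>L(X,Y)\<close> commutes with \<open>k\<close>, it preserves the eigenspaces of \<open>k\<close>, which are mutually orthogonal. As \<open>kZ\<close>
  equals \<open>cZ\<close> at \<open>p\<close> only, the formula above is needed for \<open>L(X,Y)kZ = c L(X,Y)Z\<close> at \<open>p\<close>.
\<close>

lemma leaf_curvature_mixed:
  assumes H: "X \<in> H" "Y \<in> H" "Z \<in> H" "W \<in> H" and c: "c \<noteq> d"
    and Z: "\<And>T. T \<in> V \<Longrightarrow> g T (k Z) p = c * g T Z p"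
    and W: "\<And>T. T \<in> V \<Longrightarrow> g T (k W) p = d * g T W p"
  shows "g (leaf_curvature X Y Z) W p = 0"
proof -
  note v = H[THEN H_V]
  have "g (leaf_curvature X Y (k Z)) W p = d * g (leaf_curvature X Y Z) W p"
    using leaf_curvature_commute(1)[OF H(1-3)] W leaf_curvature_V[OF H(1-3)] v by simp
  moreover have "g (leaf_curvature X Y (k Z)) W p = c * g (leaf_curvature X Y Z) W p"
  proof -
    have l: "g T (k Z) p = c * g T Z p" "g T (\<phi> (k Z)) p = c * g T (\<phi> Z) p"
      "g (\<phi> (k Z)) T p = c * g (\<phi> Z) T p" if "T \<in> V" for T
      using Z[OF that] Z[of "\<phi> T"] that v g_sym[of "\<phi> (k Z)" T] g_sym[of "\<phi> Z" T] by simp_all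
    have "g (leaf_curvature X Y (k Z)) W p - c * g (leaf_curvature X Y Z) W p = 0"
      using H v by (simp add: leaf_curvature_formula l del: g_phi g_k) (simp add: algebra_simps)
    then show ?thesis by simp
  qed
  ultimately show ?thesis using c by auto
qed

text \<open>
  The vectors \<open>\<phi>e\<^sub>1, \<phi>e\<^sub>2\<close> have eigenvalue \<open>-c\<close>. Therefore \<open>L(e\<^sub>1,\<phi>e\<^sub>1,e\<^sub>2,\<phi>e\<^sub>2)\<close>, \<open>L(e\<^sub>1,\<phi>e\<^sub>2,e\<^sub>2,\<phi>e\<^sub>1)\<close> and
  \<open>L(e\<^sub>1,\<phi>e\<^sub>2,\<phi>e\<^sub>2,e\<^sub>1)\<close> vanish, which gives \<open>f\<^sub>2 = 0\<close>, \<open>f\<^sub>5 = 0\<close> and the first equation, in this order. The second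
  one is \<open>L(e\<^sub>1,e\<^sub>2,\<phi>e\<^sub>2,\<phi>e\<^sub>1) = L(e\<^sub>1,e\<^sub>2,e\<^sub>2,e\<^sub>1)\<close>, which holds because \<open>L(e\<^sub>1,e\<^sub>2)\<close> commutes with \<open>\<phi>\<close>.
\<close>

lemma eigenpair_equations:
  assumes e: "e1 \<in> H" "e2 \<in> H" and c: "c \<noteq> 0"
    and k1: "\<And>T. T \<in> V \<Longrightarrow> g T (k e1) p = c * g T e1 p"
    and k2: "\<And>T. T \<in> V \<Longrightarrow> g T (k e2) p = c * g T e2 p"
    and on: "g e1 e1 p = 1" "g e2 e2 p = 1" "g e1 e2 p = 0" "g e1 (\<phi> e2) p = 0"
  shows "f1 p + 1 = c\<^sup>2" "f1 p + 1 + c\<^sup>2 + 2 * c * (1 - f7 p) = 0"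
proof -
  note v = e[THEN H_V]
  have on': "g e2 e1 p = 0" "g e2 (\<phi> e1) p = 0" "g e1 (\<phi> e1) p = 0" "g e2 (\<phi> e2) p = 0"
    using on fun_cong[OF g_sym[of e1 e2], of p] fun_cong[OF g_sym[of e2 "\<phi> e1"], of p]
      fun_cong[OF g_sym[of e1 "\<phi> e1"], of p] fun_cong[OF g_sym[of e2 "\<phi> e2"], of p] v by simp_all
  have kp: "g T (\<phi> (k e1)) p = c * g T (\<phi> e1) p" "g T (\<phi> (k e2)) p = c * g T (\<phi> e2) p" if "T \<in> V" for T
    using k1[of "\<phi> T"] k2[of "\<phi> T"] that v by simp_all
  have k': "g T (k (\<phi> e1)) p = - c * g T (\<phi> e1) p" "g T (k (\<phi> e2)) p = - c * g T (\<phi> e2) p" if "T \<in> V" for T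
    using kp[OF that] that v by simp_all
  have pH: "\<phi> e1 \<in> H" "\<phi> e2 \<in> H" using v by simp_all
  have cc: "c \<noteq> - c" "- c \<noteq> c" using c by auto
  note ev = leaf_curvature_formula e pH v on on' k1 k2 kp
  have "g (leaf_curvature e1 (\<phi> e1) e2) (\<phi> e2) p = 0"
    by (rule leaf_curvature_mixed[where c=c and d="-c"]) (use e pH cc k2 k' in auto)
  then have f2: "f2 p = 0" by (simp add: ev)
  have "g (leaf_curvature e1 (\<phi> e2) e2) (\<phi> e1) p = 0"
    by (rule leaf_curvature_mixed[where c=c and d="-c"]) (use e pH cc k2 k' in auto)
  then have f5: "f5 p = 0" using f2 c by (simp add: ev)
  have "g (leaf_curvature e1 (\<phi> e2) (\<phi> e2)) e1 p = 0"
    by (rule leaf_curvature_mixed[where c="-c" and d=c]) (use e pH cc k1 k' in auto)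
  then show "f1 p + 1 = c\<^sup>2" using f2 f5 by (simp add: ev power2_eq_square)
  have "g (leaf_curvature e1 e2 (\<phi> e2)) (\<phi> e1) p = g (leaf_curvature e1 e2 e2) e1 p"
    using leaf_curvature_commute(2)[OF e(1,2,2)] leaf_curvature_V[OF e(1,2,2)] v e
    by (simp add: leaf_curvature_def)
  then show "f1 p + 1 + c\<^sup>2 + 2 * c * (1 - f7 p) = 0"
    using f2 f5 by (simp add: ev power2_eq_square algebra_simps)
qed

section \<open>Eigenvectors of the shape operator\<close>

text \<open>
  For a section \<open>Y\<close> of \<open>ker \<eta>\<close> not vanishing at \<open>p\<close>, either \<open>Y + kY/c\<close> or \<open>Y - kY/c\<close> does not vanish there. The former is an
  eigenvector for \<open>c\<close>, the latter for \<open>-c\<close>, and \<open>\<phi>\<close> turns it into one for \<open>c\<close>. If \<open>Y\<close> is orthogonal to \<open>W\<close> and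
  \<open>\<phi>W\<close> for an eigenvector \<open>W\<close>, then the eigenvector obtained from \<open>Y\<close> is orthogonal to \<open>W\<close>.
\<close>

lemma eigenvector_exists:
  assumes c: "c \<noteq> 0" "c\<^sup>2 = \<sigma> p"
    and S: "finite S" "S \<subseteq> H" "card S \<le> 1" "\<And>W T. W \<in> S \<Longrightarrow> T \<in> V \<Longrightarrow> g T (k W) p = c * g T W p"
  obtains e where "e \<in> H" "g e e p = 1" "\<And>T. T \<in> V \<Longrightarrow> g T (k e) p = c * g T e p"
    "\<And>W. W \<in> S \<Longrightarrow> g W e p = 0"
proof -
  have SV: "S \<union> \<phi> ` S \<subseteq> V" using S(2) H_V by auto
  have "card (S \<union> \<phi> ` S) \<le> 3"
    using card_Un_le[of S "\<phi> ` S"] card_image_le[OF S(1), of \<phi>] S(3) by linarith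
  then obtain Y where Y: "Y \<in> H" "g Y Y p \<noteq> 0" "\<And>W. W \<in> S \<union> \<phi> ` S \<Longrightarrow> g W Y p = 0"
    using orthogonal_horizontal_exists[of "S \<union> \<phi> ` S" p thesis] S(1) SV by simp
  note y = H_V[OF Y(1)]
  have kk: "g T (k (k Y)) p = c\<^sup>2 * g T Y p" if "T \<in> V" for T
    using k_k[OF Y(1)] that y c(2) by simp
  define u where "u = Y + (\<lambda>q. 1 / c) \<odot> k Y"
  define w where "w = \<phi> (Y - (\<lambda>q. 1 / c) \<odot> k Y)"
  have H: "u \<in> H" "w \<in> H" using Y(1) y by (simp_all add: u_def w_def)
  have eigen: "g T (k u) p = c * g T u p" "g T (k w) p = c * g T w p" if "T \<in> V" for T
    using that y c(1) kk[OF that] kk[of "\<phi> T"]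
    by (simp_all add: u_def w_def field_simps power2_eq_square)
  have perp: "g W u p = 0" "g W w p = 0" if "W \<in> S" for W
  proof -
    have W: "W \<in> V" using that S(2) H_V by blast
    have "g Y (k W) p = c * g Y W p" "g (\<phi> Y) (k W) p = c * g (\<phi> Y) W p"
      using S(4)[OF that] y by simp_all
    then show "g W u p = 0" "g W w p = 0"
      using that Y(3)[of W] Y(3)[of "\<phi> W"] y W
        fun_cong[OF g_sym[of Y "k W"], of p] fun_cong[OF g_sym[of Y W], of p]
        fun_cong[OF g_sym[of "\<phi> Y" "k W"], of p] fun_cong[OF g_sym[of "\<phi> Y" W], of p]
      by (simp_all add: u_def w_def)
  qed
  have "g u u p + g w w p = 4 * g Y Y p"
    using y Y(1) c(1) kk[OF y] by (simp add: u_def w_def field_simps power2_eq_square)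
  then have "g u u p \<noteq> 0 \<or> g w w p \<noteq> 0" using Y(2) by auto
  then obtain e where e: "e \<in> H" "g e e p \<noteq> 0" "\<And>T. T \<in> V \<Longrightarrow> g T (k e) p = c * g T e p"
    "\<And>W. W \<in> S \<Longrightarrow> g W e p = 0"
    using H eigen perp by metis
  note v = H_V[OF e(1)]
  define r where "r = 1 / sqrt (g e e p)"
  have r: "r * r * g e e p = 1" using g_nonneg[OF v, of p] e(2) by (simp add: r_def)
  show ?thesis
    by (rule that[of "(\<lambda>q. r) \<odot> e"]) (use e v r SV in \<open>auto simp: mult.assoc\<close>)
qed

lemma space_form_impossible: False
proof -
  fix p :: 'a
  define c where "c = sqrt (\<sigma> p)"
  have c: "c \<noteq> 0" "c\<^sup>2 = \<sigma> p" using sigma_pos[of p] by (simp_all add: c_def)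
  obtain e1 where e1: "e1 \<in> H" "g e1 e1 p = 1" "\<And>T. T \<in> V \<Longrightarrow> g T (k e1) p = c * g T e1 p"
    using eigenvector_exists[OF c, of "{}" thesis] by simp
  obtain e2 where e2: "e2 \<in> H" "g e2 e2 p = 1" "\<And>T. T \<in> V \<Longrightarrow> g T (k e2) p = c * g T e2 p"
    "g e1 e2 p = 0"
    using eigenvector_exists[OF c, of "{e1}" thesis] e1 by simp
  note v = H_V[OF e1(1)] H_V[OF e2(1)]
  \<comment> \<open>eigenvectors for the different eigenvalues \<open>c\<close> and \<open>-c\<close> of a symmetric operator\<close>
  have o: "g e1 (\<phi> e2) p = 0"
    using e1(3)[of "\<phi> e2"] e2(3)[of "\<phi> e1"] v c(1)
      fun_cong[OF g_sym[of e1 "\<phi> e2"], of p] fun_cong[OF g_sym[of e1 "\<phi> (k e2)"], of p] by simp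
  have k': "g T (k (\<phi> e1)) p = - c * g T (\<phi> e1) p" "g T (k (\<phi> e2)) p = - c * g T (\<phi> e2) p" if "T \<in> V" for T
    using e1(3)[of "\<phi> T"] e2(3)[of "\<phi> T"] that v by simp_all
  have 1: "f1 p + 1 = c\<^sup>2" "f1 p + 1 + c\<^sup>2 + 2 * c * (1 - f7 p) = 0"
    using eigenpair_equations[OF e1(1) e2(1) c(1) e1(3) e2(3) e1(2) e2(2,4) o] by simp_all
  \<comment> \<open>\<open>\<phi>\<close> exchanges the two eigenspaces, so \<open>\<phi>e\<^sub>1, \<phi>e\<^sub>2\<close> are an eigenpair for \<open>-c\<close>\<close>
  have "f1 p + 1 + (- c)\<^sup>2 + 2 * (- c) * (1 - f7 p) = 0"
    by (rule eigenpair_equations(2)[of "\<phi> e1" "\<phi> e2"]) (use v e1 e2 c(1) k' o in simp_all)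
  with 1 have "c\<^sup>2 = 0" by simp
  then show False using c(1) by simp
qed

end

theorem proposition3p26:
  fixes A :: "('a::{t2_space, second_countable_topology}, 'e::euclidean_space) atlas"
  assumes "DIM('e) \<ge> 5"
  shows "\<not> (\<exists>\<phi> \<xi> \<eta> g f1 f2 f3 f4 f5 f6 f7 f8.
    almost_kenmotsu_manifold A \<phi> \<xi> \<eta> g \<and>
    generalized_kmn_space_form A \<phi> \<xi> \<eta> g f1 f2 f3 f4 f5 f6 f7 f8 \<and>
    (\<forall>p. f1 p - f3 p < -1))"
proof (intro notI, elim exE conjE)
  fix \<phi> \<xi> \<eta> g f1 f2 f3 f4 f5 f6 f7 f8
  assume K: "almost_kenmotsu_manifold A \<phi> \<xi> \<eta> g"
    and S: "generalized_kmn_space_form A \<phi> \<xi> \<eta> g f1 f2 f3 f4 f5 f6 f7 f8"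
    and kappa: "\<forall>p. f1 p - f3 p < -1"
  obtain D where "levi_civita A g D" "hypothetical_space_form_axioms A \<phi> \<xi> \<eta> g D f1 f2 f3 f4 f5 f6 f7 f8"
    using S kappa assms unfolding generalized_kmn_space_form_def hypothetical_space_form_axioms_def by metis
  then have "hypothetical_space_form A \<phi> \<xi> \<eta> g D f1 f2 f3 f4 f5 f6 f7 f8"
    using K by (simp add: hypothetical_space_form_def almost_kenmotsu_def)
  then show False by (rule hypothetical_space_form.space_form_impossible)
qed

end
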